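(* Let $T>0$, $p\in[1,\infty)$, and let $b:[0,T]\times\mathbb{R}^d\times\mathcal{P}_p(\mathbb{R}^d)\to\mathbb{R}^d$ be a measurable function for which there is a constant $K_b$ such that $$|b(t,x,\mu)-b(t,x',\mu')|^p\le K_b\big(|x-x'|^p+\mathcal{W}_{\mathbb{R}^d,p}(\mu,\mu')^p\big)$$ for all $t\in[0,T]$, $x,x'\in\mathbb{R}^d$, $\mu,\mu'\in\mathcal{P}_p(\mathbb{R}^d)$. Then: (i) For every input $(\zeta,W)\in L^p(\mathbb{R}^d\times C_T)$, the map $\Phi^{\mathcal{L}(\zeta,W)}:=\Phi(\mathcal{L}(\zeta,W),\cdot):\mathcal{P}_p(C_T)\to\mathcal{P}_p(C_T)$ has a unique fixed point, denoted $\mu^{\mathcal{L}(\zeta,W)}$. (ii) The map $\Psi:\mathcal{P}_p(\mathbb{R}^d\times C_T)\to\mathcal{P}_p(C_T)$, $\nu\mapsto\mu^{\nu}$, that associates to the law of the inputs the fixed point, is well defined and Lipschitz continuous (with respect to the $p$-Wasserstein metrics). (iii) For every input $(\zeta,W)\in L^p(\mathbb{R}^d\times C_T)$ there exists a unique (up to almost sure equality) solution $X$ to the generalized McKean-Vlasov equation $$dX_t=b(t,X_t,\mathcal{L}(X_t))\,dt+dW_t,\qquad X_0=\zeta,$$ and it is given by $X=S^{\Psi(\mathcal{L}(\zeta,W))}(\zeta,W)$. (iv) There exists a constant $\tilde C=\tilde C(p,T,b)>0$ such that for every two inputs $(\zeta^i,W^i)$, $i=1,2$ (defined possibly on different probability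 spaces), with finite $p$-moments, the corresponding solutions $X^1,X^2$ satisfy $$\mathcal{W}_{C_T,p}(\mathcal{L}(X^1),\mathcal{L}(X^2))\le\tilde C\,\mathcal{W}_{\mathbb{R}^d\times C_T,p}(\mathcal{L}(\zeta^1,W^1),\mathcal{L}(\zeta^2,W^2)).$$ In particular, the law of a solution $X$ depends only on the law of $(\zeta,W)$.
   Context: $C_T:=C([0,T],\mathbb{R}^d)$ carries the supremum norm $\|\cdot\|_\infty$, and $\mathbb{R}^d\times C_T$ a product norm, e.g. $|x|+\|\gamma\|_\infty$. For a separable Banach space $E$, $\mathcal{P}_p(E)$ is the set of Borel probability measures on $E$ with finite $p$-th moment, endowed with the $p$-Wasserstein metric $\mathcal{W}_{E,p}(\mu,\nu)^p=\inf_{m\in\Gamma(\mu,\nu)}\iint\|x-y\|_E^p\,m(dx,dy)$, $\Gamma(\mu,\nu)$ being the set of couplings of $\mu$ and $\nu$. $\mathcal{L}(Y)$ is the law of a random variable $Y$, and for $\mu\in\mathcal{P}_p(C_T)$, $\mu_t\in\mathcal{P}_p(\mathbb{R}^d)$ is its marginal at time $t$ (push-forward under $\gamma\mapsto\gamma_t$). An input is a random variable $(\zeta,W)$ on some probability space $(\Omega,\mathcal{A},\mathbb{P})$ with values in $\mathbb{R}^d\times C_T$; $(\zeta,W)\in L^p(\mathbb{R}^d\times C_T)$ means $\mathbb{E}|\zeta|^p+\mathbb{E}\|W\|_\infty^p<\infty$. No filtration or distributional assumption is made on $W$. A solution with input $(\zeta,W)$ is a random variable $X:\Omega\to C_T$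 such that for a.e. $\omega$, for all $t\in[0,T]$, $X_t(\omega)=\zeta(\omega)+\int_0^t b(s,X_s(\omega),\mathcal{L}(X_s))\,ds+W_t(\omega)$ (so in particular $\mathcal{L}(X_s)\in\mathcal{P}_p(\mathbb{R}^d)$). For $\mu\in\mathcal{P}_p(C_T)$, $S^\mu:\mathbb{R}^d\times C_T\to C_T$ maps $(x_0,\gamma)$ to the unique solution $x\in C_T$ of $x_t=x_0+\int_0^t b(s,x_s,\mu_s)\,ds+\gamma_t$, $t\in[0,T]$. The map $\Phi:\mathcal{P}_p(\mathbb{R}^d\times C_T)\times\mathcal{P}_p(C_T)\to\mathcal{P}_p(C_T)$ is $\Phi(\nu,\mu):=(S^\mu)_\#\nu$ (push-forward of $\nu$ under $S^\mu$).
   Formalization: Adds that t↦b(t,0,δ_0) is integrable on [0,T]; without it b=v/t has no solution, and S^μ exists only under it. The constant in (iv) is stated per pair of sample-space types; one constant for all follows from (ii) and (iii), as L(X)=Ψ(L(ζ,W)). *)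

theory Defs
  imports "HOL-Probability.Probability"
begin

(* C([0,T],R^d): a path on [0,T] is identified with its extension to the real line by constants.
   The norm inherited from the bounded continuous functions is then the supremum norm over [0,T]. *)
definition paths :: "real \<Rightarrow> (real \<Rightarrow>\<^sub>C 'a::euclidean_space) set" where
  "paths T = {f :: real \<Rightarrow>\<^sub>C 'a. (\<forall>t\<le>0. f t = f 0) \<and> (\<forall>t\<ge>T. f t = f T)}"

(* The type of all bounded continuous functions on the line is not separable; every sigma-algebra
   below lives on the separable subspace E only. *)
definition borel_on :: "'e::topological_space set \<Rightarrow> 'e measure" where
  "borel_on E = restrict_space borel E"

definition wspace :: "real \<Rightarrow> 'e::real_normed_vector set \<Rightarrow> 'e measure set" where
  "wspace p E = {\<mu>. prob_space \<mu> \<and> sets \<mu> = sets (borel_on E) \<and>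
                     (\<integral>\<^sup>+ x. ennreal (norm x powr p) \<partial>\<mu>) < \<infinity>}"

definition couplings :: "'e measure \<Rightarrow> 'e measure \<Rightarrow> ('e \<times> 'e) measure set" where
  "couplings \<mu> \<nu> = {m. prob_space m \<and> sets m = sets (\<mu> \<Otimes>\<^sub>M \<nu>) \<and>
                        distr m \<mu> fst = \<mu> \<and> distr m \<nu> snd = \<nu>}"

(* Only meant for measures in wspace p E, where the infimum is finite. *)
definition wasserstein :: "real \<Rightarrow> 'e::real_normed_vector measure \<Rightarrow> 'e measure \<Rightarrow> real" where
  "wasserstein p \<mu> \<nu> =
     enn2real (INF m\<in>couplings \<mu> \<nu>. \<integral>\<^sup>+ (x, y). ennreal (norm (x - y) powr p) \<partial>m) powr (1 / p)"

(* Borel sigma-algebra of the metric space (wspace p E, wasserstein p), generated by its open sets. *)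
definition wborel :: "real \<Rightarrow> 'e::real_normed_vector set \<Rightarrow> 'e measure measure" where
  "wborel p E = sigma (wspace p E)
     {U. U \<subseteq> wspace p E \<and>
         (\<forall>\<mu>\<in>U. \<exists>\<epsilon>>0. \<forall>\<nu>\<in>wspace p E. wasserstein p \<mu> \<nu> < \<epsilon> \<longrightarrow> \<nu> \<in> U)}"

type_synonym 'a drift = "real \<Rightarrow> 'a \<Rightarrow> 'a measure \<Rightarrow> 'a"

definition marginal :: "(real \<Rightarrow>\<^sub>C 'a::euclidean_space) measure \<Rightarrow> real \<Rightarrow> 'a measure" where
  "marginal \<mu> t = distr \<mu> borel (\<lambda>\<gamma>. \<gamma> t)"

(* x solves x_t = x0 + int_0^t b(s, x_s, m_s) ds + g_t on [0,T] for a given flow of measures m.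
   Integrability is explicit because the Bochner integral is 0 on non-integrable functions. *)
definition solves_along ::
  "real \<Rightarrow> 'a::euclidean_space drift \<Rightarrow> (real \<Rightarrow> 'a measure) \<Rightarrow> 'a \<Rightarrow> (real \<Rightarrow>\<^sub>C 'a) \<Rightarrow> (real \<Rightarrow>\<^sub>C 'a) \<Rightarrow> bool"
  where
  "solves_along T b m x0 g x \<longleftrightarrow>
     x \<in> paths T \<and>
     set_integrable lborel {0..T} (\<lambda>s. b s (x s) (m s)) \<and>
     (\<forall>t\<in>{0..T}. x t = x0 + (LINT s:{0..t}|lborel. b s (x s) (m s)) + g t)"

definition sol_map ::
  "real \<Rightarrow> 'a::euclidean_space drift \<Rightarrow> (real \<Rightarrow>\<^sub>C 'a) measure \<Rightarrow> 'a \<times> (real \<Rightarrow>\<^sub>C 'a) \<Rightarrow> (real \<Rightarrow>\<^sub>C 'a)"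
  where
  "sol_map T b \<mu> = (\<lambda>(x0, g). THE x. solves_along T b (marginal \<mu>) x0 g x)"

definition Phi ::
  "real \<Rightarrow> 'a::euclidean_space drift \<Rightarrow> ('a \<times> (real \<Rightarrow>\<^sub>C 'a)) measure \<Rightarrow> (real \<Rightarrow>\<^sub>C 'a) measure
    \<Rightarrow> (real \<Rightarrow>\<^sub>C 'a) measure"
  where
  "Phi T b \<nu> \<mu> = distr \<nu> (borel_on (paths T)) (sol_map T b \<mu>)"

definition Psi ::
  "real \<Rightarrow> real \<Rightarrow> 'a::euclidean_space drift \<Rightarrow> ('a \<times> (real \<Rightarrow>\<^sub>C 'a)) measure \<Rightarrow> (real \<Rightarrow>\<^sub>C 'a) measure"
  where
  "Psi T p b \<nu> = (THE \<mu>. \<mu> \<in> wspace p (paths T) \<and> Phi T b \<nu> \<mu> = \<mu>)"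

(* The norm on the product type is the Euclidean combination of the two norms. *)
abbreviation inputs :: "real \<Rightarrow> ('a::euclidean_space \<times> (real \<Rightarrow>\<^sub>C 'a)) set" where
  "inputs T \<equiv> UNIV \<times> paths T"

definition Lp_input ::
  "real \<Rightarrow> real \<Rightarrow> 'w measure \<Rightarrow> ('w \<Rightarrow> 'a::euclidean_space) \<Rightarrow> ('w \<Rightarrow> (real \<Rightarrow>\<^sub>C 'a)) \<Rightarrow> bool"
  where
  "Lp_input T p M \<zeta> W \<longleftrightarrow>
     prob_space M \<and>
     (\<lambda>\<omega>. (\<zeta> \<omega>, W \<omega>)) \<in> M \<rightarrow>\<^sub>M borel_on (inputs T) \<and>
     (\<integral>\<^sup>+ \<omega>. ennreal (norm (\<zeta> \<omega>) powr p) \<partial>M) + (\<integral>\<^sup>+ \<omega>. ennreal (norm (W \<omega>) powr p) \<partial>M) < \<infinity>"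

definition input_law ::
  "real \<Rightarrow> 'w measure \<Rightarrow> ('w \<Rightarrow> 'a::euclidean_space) \<Rightarrow> ('w \<Rightarrow> (real \<Rightarrow>\<^sub>C 'a))
    \<Rightarrow> ('a \<times> (real \<Rightarrow>\<^sub>C 'a)) measure"
  where
  "input_law T M \<zeta> W = distr M (borel_on (inputs T)) (\<lambda>\<omega>. (\<zeta> \<omega>, W \<omega>))"

definition path_law :: "real \<Rightarrow> 'w measure \<Rightarrow> ('w \<Rightarrow> (real \<Rightarrow>\<^sub>C 'a::euclidean_space)) \<Rightarrow> (real \<Rightarrow>\<^sub>C 'a) measure"
  where
  "path_law T M X = distr M (borel_on (paths T)) X"

definition mkv_solution ::
  "real \<Rightarrow> real \<Rightarrow> 'a::euclidean_space drift \<Rightarrow> 'w measure \<Rightarrow> ('w \<Rightarrow> 'a) \<Rightarrow> ('w \<Rightarrow> (real \<Rightarrow>\<^sub>C 'a))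
    \<Rightarrow> ('w \<Rightarrow> (real \<Rightarrow>\<^sub>C 'a)) \<Rightarrow> bool"
  where
  "mkv_solution T p b M \<zeta> W X \<longleftrightarrow>
     X \<in> M \<rightarrow>\<^sub>M borel_on (paths T) \<and>
     (\<forall>s\<in>{0..T}. distr M borel (\<lambda>\<omega>. X \<omega> s) \<in> wspace p UNIV) \<and>
     (AE \<omega> in M. solves_along T b (\<lambda>s. distr M borel (\<lambda>\<omega>'. X \<omega>' s)) (\<zeta> \<omega>) (W \<omega>) (X \<omega>))"

end

theory Submission
  imports Defs
begin

text \<open>
  Two solutions along flows of marginals \<open>m\<close>, \<open>m'\<close> satisfy, by a Gronwall argument in the weighted norm
  \<open>sup\<^sub>t exp (- 3 C t) |x\<^sub>t|\<close>, the estimate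
  \<open>|x\<^sub>t - y\<^sub>t| \<le> (3/2 (|x\<^sub>0 - y\<^sub>0| + |g - g'|) + A/2) exp (3 C t)\<close> as soon as
  \<open>W\<^sub>p(m\<^sub>s, m'\<^sub>s) \<le> A exp (3 C s)\<close> on \<open>[0, T]\<close>. The contribution of the flows is halved and is
  deterministic, hence uniform in the input. So \<open>X \<mapsto> S\<^bsup>law X\<^esup>\<close> contracts the supremum over
  all inputs, and a fixed point of \<open>\<Phi>(\<nu>, \<cdot>)\<close> is the law of a uniform limit of
  random variables: completeness of the Wasserstein space is not required. Integrating the estimate
  against an arbitrary coupling of two input laws gives uniqueness and the Lipschitz bound.
\<close>

subsection \<open>Couplings and Wasserstein distances\<close>

text \<open>The rate 3 in the weight is what produces the halving. Integrating \<open>C\<close>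
  times the weight gives back at most a third of the weight; once the third that belongs to the
  unknown is absorbed, the input data carry the factor 3/2 and the flows carry 1/3 * 3/2 = 1/2. A
  supremum over inputs is finite only when two flows are compared at the same input. For two input
  laws the distance of paired inputs is unbounded, so there the estimate is raised to the power
  \<open>p\<close> before it is integrated, and the distance between the two flows is absorbed a
  second time, now at the level of p-th powers.\<close>

lemma powr_add_le_add_powr:
  fixes x y p :: real
  assumes "p \<ge> 1" "x \<ge> 0" "y \<ge> 0"
  shows "x powr p + y powr p \<le> (x + y) powr p"
proof -
  have *: "z powr p = z * z powr (p - 1)" if "z \<ge> 0" for z :: real
    using that assms(1) by (cases "z = 0") (auto simp: powr_diff)
  have "x * x powr (p - 1) + y * y powr (p - 1) \<le> x * (x + y) powr (p - 1) + y * (x + y) powr (p - 1)"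
    using assms by (intro add_mono mult_left_mono powr_mono2) auto
  then show ?thesis
    using assms by (simp add: * algebra_simps)
qed

text \<open>Convexity of the p-th power at the midpoint of \<open>x\<close> and \<open>y\<close>; a
  vanishing argument is treated apart and only needs \<open>1 \<le> 2 powr (p - 1)\<close>.\<close>

lemma add_powr_le:
  fixes x y p :: real
  assumes "p \<ge> 1" "x \<ge> 0" "y \<ge> 0"
  shows "(x + y) powr p \<le> 2 powr (p - 1) * (x powr p + y powr p)"
proof -
  have two: "1 \<le> (2::real) powr (p - 1)"
    using assms(1) by (simp add: ge_one_powr_ge_zero)
  consider "x = 0" | "y = 0" | "x > 0" "y > 0"
    using assms by fastforce
  then show ?thesis
  proof cases
    case 3
    have "((1 - 1/2) *\<^sub>R x + (1/2) *\<^sub>R y) powr p \<le> (1 - 1/2) * x powr p + (1/2) * y powr p"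
      using 3 by (intro convex_onD[OF powr_convex[OF assms(1)]]) auto
    then have "((x + y) / 2) powr p \<le> (x powr p + y powr p) / 2"
      by (simp add: field_simps)
    then have "(x + y) powr p \<le> 2 powr p * ((x powr p + y powr p) / 2)"
      using 3 by (simp add: powr_divide field_simps)
    then show ?thesis
      by (simp add: powr_diff)
  qed (use assms mult_right_mono[OF two, of "(x + y) powr p"] in auto)
qed

text \<open>Upper bounds on distances between laws come from realising both laws on one probability
  space; the moment bound \<open>wasserstein_powr_le_moment\<close> uses the product coupling
  instead.\<close>

lemma coupling_distr_Pair:
  assumes "prob_space N" and X[measurable]: "X \<in> N \<rightarrow>\<^sub>M A" and Y[measurable]: "Y \<in> N \<rightarrow>\<^sub>M B"
  shows "distr N (A \<Otimes>\<^sub>M B) (\<lambda>\<omega>. (X \<omega>, Y \<omega>)) \<in> couplings (distr N A X) (distr N B Y)"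
proof -
  let ?m = "distr N (A \<Otimes>\<^sub>M B) (\<lambda>\<omega>. (X \<omega>, Y \<omega>))"
  have "distr ?m (distr N A X) fst = distr ?m A fst" "distr ?m (distr N B Y) snd = distr ?m B snd"
    by (rule distr_cong; simp)+
  moreover have "prob_space ?m"
    using assms(1) by (rule prob_space.prob_space_distr) measurable
  moreover have "sets ?m = sets (distr N A X \<Otimes>\<^sub>M distr N B Y)"
    by (simp cong: sets_pair_measure_cong)
  ultimately show ?thesis
    by (simp add: couplings_def distr_distr comp_def)
qed

lemma coupling_pair_measure:
  assumes "prob_space \<mu>" "prob_space \<nu>"
  shows "\<mu> \<Otimes>\<^sub>M \<nu> \<in> couplings \<mu> \<nu>"
proof -
  interpret pair_prob_space \<mu> \<nu>
    using assms by (simp add: pair_prob_space_def pair_sigma_finite_def prob_space_imp_sigma_finite)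
  have "distr (\<mu> \<Otimes>\<^sub>M \<nu>) \<nu> snd = \<nu>"
  proof -
    have "distr (\<mu> \<Otimes>\<^sub>M \<nu>) \<nu> snd = distr (\<nu> \<Otimes>\<^sub>M \<mu>) \<nu> fst"
      by (subst distr_pair_swap) (simp add: distr_distr comp_def case_prod_beta')
    then show ?thesis
      using assms(1) by (simp add: prob_space.distr_pair_fst)
  qed
  moreover have "distr (\<mu> \<Otimes>\<^sub>M \<nu>) \<mu> fst = \<mu>"
    using assms(2) by (rule prob_space.distr_pair_fst)
  ultimately show ?thesis
    by (simp add: couplings_def prob_space_axioms)
qed

lemma wasserstein_nonneg [simp]: "wasserstein p \<mu> \<nu> \<ge> 0"
  by (simp add: wasserstein_def)

lemma wasserstein_powr:
  assumes "p > 0"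
  shows "wasserstein p \<mu> \<nu> powr p =
    enn2real (INF m\<in>couplings \<mu> \<nu>. \<integral>\<^sup>+ (x, y). ennreal (norm (x - y) powr p) \<partial>m)"
  using assms by (simp add: wasserstein_def powr_powr)

lemma wasserstein_powr_le:
  assumes "p > 0" "m \<in> couplings \<mu> \<nu>" "c \<ge> 0"
    and "(\<integral>\<^sup>+ (x, y). ennreal (norm (x - y) powr p) \<partial>m) \<le> ennreal c"
  shows "wasserstein p \<mu> \<nu> powr p \<le> c"
  unfolding wasserstein_powr[OF assms(1)]
  using assms by (intro enn2real_leI) (auto intro: INF_lower2)

lemma nn_integral_coupling_fst:
  assumes m: "m \<in> couplings \<mu> \<nu>" and f: "f \<in> borel_measurable \<mu>"
  shows "(\<integral>\<^sup>+ z. f (fst z) \<partial>m) = (\<integral>\<^sup>+ x. f x \<partial>\<mu>)"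
proof -
  have "fst \<in> m \<rightarrow>\<^sub>M \<mu>"
    using m by (auto simp: couplings_def cong: measurable_cong_sets)
  then have "(\<integral>\<^sup>+ x. f x \<partial>distr m \<mu> fst) = (\<integral>\<^sup>+ z. f (fst z) \<partial>m)"
    using f by (simp add: nn_integral_distr)
  then show ?thesis
    using m by (simp add: couplings_def)
qed

lemma nn_integral_coupling_snd:
  assumes m: "m \<in> couplings \<mu> \<nu>" and f: "f \<in> borel_measurable \<nu>"
  shows "(\<integral>\<^sup>+ z. f (snd z) \<partial>m) = (\<integral>\<^sup>+ x. f x \<partial>\<nu>)"
proof -
  have "snd \<in> m \<rightarrow>\<^sub>M \<nu>"
    using m by (auto simp: couplings_def cong: measurable_cong_sets)
  then have "(\<integral>\<^sup>+ x. f x \<partial>distr m \<nu> snd) = (\<integral>\<^sup>+ z. f (snd z) \<partial>m)"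
    using f by (simp add: nn_integral_distr)
  then show ?thesis
    using m by (simp add: couplings_def)
qed

text \<open>A real number without the p-th root, so that bounds stay additive; on
  \<open>wspace\<close> the conversion \<open>enn2real\<close> loses nothing.\<close>

definition moment :: "real \<Rightarrow> 'e::real_normed_vector measure \<Rightarrow> real" where
  "moment p \<mu> = enn2real (\<integral>\<^sup>+ x. ennreal (norm x powr p) \<partial>\<mu>)"

lemma moment_nonneg [simp]: "moment p \<mu> \<ge> 0"
  by (simp add: moment_def)

lemma nn_integral_moment:
  assumes "\<mu> \<in> wspace p E"
  shows "(\<integral>\<^sup>+ x. ennreal (norm x powr p) \<partial>\<mu>) = ennreal (moment p \<mu>)"
  using assms by (auto simp: wspace_def moment_def ennreal_enn2real)

lemma norm_measurable_borel_on: "norm \<in> borel_measurable (borel_on E)"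
  unfolding borel_on_def by (intro measurable_restrict_space1 borel_measurable_continuous_onI continuous_intros)

lemma wspace_norm_measurable:
  assumes "\<mu> \<in> wspace p E"
  shows "norm \<in> borel_measurable \<mu>"
  using assms norm_measurable_borel_on[of E] by (auto simp: wspace_def cong: measurable_cong_sets)

lemma nn_integral_norm_diff_coupling_le:
  assumes p: "p \<ge> 1" and \<mu>: "\<mu> \<in> wspace p E" and \<nu>: "\<nu> \<in> wspace p E" and m: "m \<in> couplings \<mu> \<nu>"
  shows "(\<integral>\<^sup>+ (x, y). ennreal (norm (x - y) powr p) \<partial>m) \<le> ennreal (2 powr (p - 1) * (moment p \<mu> + moment p \<nu>))"
proof -
  note [measurable] = wspace_norm_measurable[OF \<mu>] wspace_norm_measurable[OF \<nu>]
  have sets_m [measurable_cong]: "sets m = sets (\<mu> \<Otimes>\<^sub>M \<nu>)"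
    using m by (simp add: couplings_def)
  have "norm (x - y) powr p \<le> 2 powr (p - 1) * (norm x powr p + norm y powr p)" for x y :: 'a
    using p by (intro order.trans[OF powr_mono2 add_powr_le]) (auto intro: norm_triangle_ineq4)
  then have "(\<integral>\<^sup>+ (x, y). ennreal (norm (x - y) powr p) \<partial>m)
      \<le> (\<integral>\<^sup>+ z. ennreal (2 powr (p - 1)) * (ennreal (norm (fst z) powr p) + ennreal (norm (snd z) powr p)) \<partial>m)"
    by (intro nn_integral_mono) (auto simp: ennreal_mult[symmetric] ennreal_plus[symmetric] simp del: ennreal_plus intro!: ennreal_leI)
  also have "\<dots> = ennreal (2 powr (p - 1)) *
      ((\<integral>\<^sup>+ z. ennreal (norm (fst z) powr p) \<partial>m) + (\<integral>\<^sup>+ z. ennreal (norm (snd z) powr p) \<partial>m))"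
    by (subst nn_integral_cmult) (auto simp: nn_integral_add)
  also have "\<dots> = ennreal (2 powr (p - 1)) * (ennreal (moment p \<mu>) + ennreal (moment p \<nu>))"
    by (subst nn_integral_coupling_fst[OF m], measurable, subst nn_integral_coupling_snd[OF m], measurable)
      (simp add: nn_integral_moment[OF \<mu>] nn_integral_moment[OF \<nu>])
  finally show ?thesis
    by (simp add: ennreal_mult)
qed

lemma wasserstein_powr_le_moment:
  assumes "p \<ge> 1" "\<mu> \<in> wspace p E" "\<nu> \<in> wspace p E"
  shows "wasserstein p \<mu> \<nu> powr p \<le> 2 powr (p - 1) * (moment p \<mu> + moment p \<nu>)"
  using assms nn_integral_norm_diff_coupling_le[OF assms coupling_pair_measure] coupling_pair_measure
  by (intro wasserstein_powr_le) (auto simp: wspace_def)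

text \<open>A lower bound on the distance is checked on each coupling of finite cost, so no optimal
  coupling has to exist.\<close>

lemma le_wassersteinI:
  assumes p: "p \<ge> 1" and \<mu>: "\<mu> \<in> wspace p E" and \<nu>: "\<nu> \<in> wspace p E" and "d \<ge> 0"
    and le: "\<And>m c. m \<in> couplings \<mu> \<nu> \<Longrightarrow> c \<ge> 0 \<Longrightarrow>
      (\<integral>\<^sup>+ (x, y). ennreal (norm (x - y) powr p) \<partial>m) = ennreal c \<Longrightarrow> d powr p \<le> c"
  shows "d \<le> wasserstein p \<mu> \<nu>"
proof -
  let ?I = "INF m\<in>couplings \<mu> \<nu>. \<integral>\<^sup>+ (x, y). ennreal (norm (x - y) powr p) \<partial>m"
  have "ennreal (d powr p) \<le> ?I"
  proof (rule INF_greatest)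
    fix m assume m: "m \<in> couplings \<mu> \<nu>"
    let ?J = "\<integral>\<^sup>+ (x, y). ennreal (norm (x - y) powr p) \<partial>m"
    show "ennreal (d powr p) \<le> ?J"
      by (cases ?J) (use le[OF m] in \<open>auto intro!: ennreal_leI\<close>)
  qed
  \<comment> \<open>\<open>enn2real\<close> sends infinity to 0, so the lower bound survives the
    conversion only because the infimum is finite; the product coupling witnesses this.\<close>
  moreover have "?I < \<infinity>"
    using \<mu> \<nu> nn_integral_norm_diff_coupling_le[OF p \<mu> \<nu>] coupling_pair_measure[of \<mu> \<nu>]
    by (intro INF_lower2[THEN le_less_trans, where i1="\<mu> \<Otimes>\<^sub>M \<nu>"])
      (auto simp: wspace_def intro!: le_less_trans[OF _ ennreal_less_top])
  ultimately have "d powr p \<le> enn2real ?I"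
    using enn2real_mono[of "ennreal (d powr p)" ?I] by simp
  then have "d powr p \<le> wasserstein p \<mu> \<nu> powr p"
    using p by (simp add: wasserstein_powr)
  then show ?thesis
    using p \<open>d \<ge> 0\<close> powr_less_mono2[of p "wasserstein p \<mu> \<nu>" d] by (fastforce simp: not_le[symmetric])
qed

text \<open>The norm of the difference is continuous, hence measurable for the Borel sets of the product, but
  these may be strictly larger than the product sigma-algebra when the ambient type is not separable.\<close>

definition diff_measurable :: "'e::real_normed_vector set \<Rightarrow> bool" where
  "diff_measurable E \<longleftrightarrow> (\<lambda>(x, y). norm (x - y)) \<in> borel_measurable (borel_on E \<Otimes>\<^sub>M borel_on E)"

lemma borel_on_UNIV [simp]: "borel_on UNIV = borel"
  unfolding borel_on_def by (rule measure_eqI) (auto simp: sets_restrict_space emeasure_restrict_space)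

lemma space_borel_on [simp]: "space (borel_on E) = E"
  by (simp add: borel_on_def space_restrict_space)

lemma measurable_borel_onI:
  assumes "continuous_on UNIV f"
  shows "f \<in> borel_on E \<rightarrow>\<^sub>M borel"
  unfolding borel_on_def using assms by (intro measurable_restrict_space1 borel_measurable_continuous_onI)

lemma continuous_on_eval_bcontfun: "continuous_on S (\<lambda>\<gamma> :: 'b::topological_space \<Rightarrow>\<^sub>C 'c::metric_space. apply_bcontfun \<gamma> t)"
  unfolding continuous_on_iff using dist_fun_lt_imp_dist_val_lt by blast

lemma eval_measurable [measurable]: "(\<lambda>\<gamma>. apply_bcontfun \<gamma> t) \<in> borel_on E \<rightarrow>\<^sub>M borel"
  by (intro measurable_borel_onI continuous_on_eval_bcontfun)

lemma norm_bcontfun_le_iff: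
  fixes x :: "'b::topological_space \<Rightarrow>\<^sub>C 'c::real_normed_vector"
  shows "norm x \<le> c \<longleftrightarrow> (\<forall>t. norm (x t) \<le> c)"
  using norm_bounded[of x] norm_bound[of x c] by (auto intro: order.trans)

lemma norm_bcontfun_le_iff_rat:
  fixes x :: "real \<Rightarrow>\<^sub>C 'c::real_normed_vector"
  shows "norm x \<le> c \<longleftrightarrow> (\<forall>t\<in>\<rat>. norm (x t) \<le> c)"
proof -
  have "(\<forall>t. norm (x t) \<le> c)" if "\<forall>t\<in>\<rat>. norm (x t) \<le> c"
  proof
    fix t
    have "closure \<rat> \<subseteq> {s. norm (x s) \<le> c}"
      using that by (intro closure_minimal closed_Collect_le continuous_intros) auto
    then show "norm (x t) \<le> c"
      by (auto simp: Rats_closure_real)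
  qed
  then show ?thesis
    unfolding norm_bcontfun_le_iff by blast
qed

lemma diff_measurable_UNIV: "diff_measurable (UNIV :: 'a::euclidean_space set)"
  unfolding diff_measurable_def by simp

text \<open>By continuity of paths, the norm of a difference is at most \<open>c\<close> iff this
  holds at all rational times. Each evaluation is measurable on its own factor, so the sublevel sets
  are countable intersections of sets in the product sigma-algebra.\<close>

lemma diff_measurable_bcontfun: "diff_measurable (E :: (real \<Rightarrow>\<^sub>C 'a::euclidean_space) set)"
  unfolding diff_measurable_def borel_measurable_iff_le
proof
  fix c :: real
  let ?N = "borel_on E \<Otimes>\<^sub>M borel_on E"
  have "{w \<in> space ?N. (case w of (x, y) \<Rightarrow> norm (x - y)) \<le> c} =
      {w \<in> space ?N. \<forall>t\<in>\<rat>. norm (apply_bcontfun (fst w) t - apply_bcontfun (snd w) t) \<le> c}"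
    by (auto simp: norm_bcontfun_le_iff_rat)
  also have "\<dots> \<in> sets ?N"
    using countable_rat by measurable
  finally show "{w \<in> space ?N. (case w of (x, y) \<Rightarrow> norm (x - y)) \<le> c} \<in> sets ?N" .
qed

lemma diff_measurable_Times:
  assumes E: "diff_measurable E" and F: "diff_measurable F"
  shows "diff_measurable (E \<times> F)"
proof -
  have fst: "fst \<in> borel_on (E \<times> F) \<rightarrow>\<^sub>M borel_on E" and snd: "snd \<in> borel_on (E \<times> F) \<rightarrow>\<^sub>M borel_on F"
    unfolding borel_on_def
    by (auto intro!: measurable_restrict_space3 borel_measurable_continuous_onI continuous_intros)
  have "(\<lambda>w. sqrt ((norm (fst (fst w) - fst (snd w)))\<^sup>2 + (norm (snd (fst w) - snd (snd w)))\<^sup>2))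
      \<in> borel_measurable (borel_on (E \<times> F) \<Otimes>\<^sub>M borel_on (E \<times> F))"
    using measurable_compose[OF _ E[unfolded diff_measurable_def], of "\<lambda>w. (fst (fst w), fst (snd w))" "borel_on (E \<times> F) \<Otimes>\<^sub>M borel_on (E \<times> F)"]
      measurable_compose[OF _ F[unfolded diff_measurable_def], of "\<lambda>w. (snd (fst w), snd (snd w))" "borel_on (E \<times> F) \<Otimes>\<^sub>M borel_on (E \<times> F)"]
      fst snd
    by simp
  then show ?thesis
    by (simp add: diff_measurable_def norm_prod_def case_prod_beta')
qed

lemma wasserstein_distr_powr_le:
  assumes E: "diff_measurable E" and N: "prob_space N"
    and X[measurable]: "X \<in> N \<rightarrow>\<^sub>M borel_on E" and Y[measurable]: "Y \<in> N \<rightarrow>\<^sub>M borel_on E"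
    and "p > 0" "c \<ge> 0"
    and le: "(\<integral>\<^sup>+ \<omega>. ennreal (norm (X \<omega> - Y \<omega>) powr p) \<partial>N) \<le> ennreal c"
  shows "wasserstein p (distr N (borel_on E) X) (distr N (borel_on E) Y) powr p \<le> c"
proof (rule wasserstein_powr_le[OF \<open>p > 0\<close> coupling_distr_Pair[OF N X Y] \<open>c \<ge> 0\<close>])
  have [measurable]: "(\<lambda>z. norm (fst z - snd z)) \<in> borel_measurable (borel_on E \<Otimes>\<^sub>M borel_on E)"
    using E by (simp add: diff_measurable_def case_prod_beta')
  show "(\<integral>\<^sup>+ (x, y). ennreal (norm (x - y) powr p)
      \<partial>distr N (borel_on E \<Otimes>\<^sub>M borel_on E) (\<lambda>\<omega>. (X \<omega>, Y \<omega>))) \<le> ennreal c"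
    using le by (simp add: case_prod_beta' nn_integral_distr)
qed

lemma wasserstein_distr_le:
  assumes "diff_measurable E" and N: "prob_space N"
    and "X \<in> N \<rightarrow>\<^sub>M borel_on E" "Y \<in> N \<rightarrow>\<^sub>M borel_on E"
    and "p > 0" and le: "\<And>\<omega>. \<omega> \<in> space N \<Longrightarrow> norm (X \<omega> - Y \<omega>) \<le> c"
  shows "wasserstein p (distr N (borel_on E) X) (distr N (borel_on E) Y) \<le> c"
proof -
  interpret prob_space N by fact
  have "c \<ge> 0"
    using not_empty le by (meson ex_in_conv norm_ge_zero order.trans)
  have "(\<integral>\<^sup>+ \<omega>. ennreal (norm (X \<omega> - Y \<omega>) powr p) \<partial>N) \<le> (\<integral>\<^sup>+ \<omega>. ennreal (c powr p) \<partial>N)"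
    using le \<open>p > 0\<close> by (intro nn_integral_mono ennreal_leI powr_mono2) auto
  then have "wasserstein p (distr N (borel_on E) X) (distr N (borel_on E) Y) powr p \<le> c powr p"
    using assms by (intro wasserstein_distr_powr_le) (auto simp: emeasure_space_1)
  then show ?thesis
    using \<open>p > 0\<close> \<open>c \<ge> 0\<close> powr_less_mono2 linorder_not_le by blast
qed

lemma wasserstein_self:
  assumes \<mu>: "\<mu> \<in> wspace p E" and "diff_measurable E" "p > 0"
  shows "wasserstein p \<mu> \<mu> = 0"
proof -
  have \<mu>': "prob_space \<mu>" "sets \<mu> = sets (borel_on E)"
    using \<mu> by (auto simp: wspace_def)
  then have "wasserstein p (distr \<mu> (borel_on E) (\<lambda>x. x)) (distr \<mu> (borel_on E) (\<lambda>x. x)) \<le> 0"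
    using assms by (intro wasserstein_distr_le) (auto intro: measurable_ident_sets)
  moreover have "distr \<mu> (borel_on E) (\<lambda>x. x) = \<mu>"
    using \<mu>' by (intro distr_id2) simp
  ultimately show ?thesis
    by (simp add: order.antisym)
qed

subsection \<open>Gronwall's inequality and fixed points in a weighted supremum norm\<close>

text \<open>Absorption: the supremum \<open>S\<close> of \<open>h\<close> satisfies
  \<open>S \<le> a + q * S\<close>. The bound \<open>B\<close> makes \<open>S\<close> finite, so
  that \<open>q * S\<close> may be subtracted, and leaves no trace in the result.\<close>

lemma self_bound:
  fixes h :: "'i \<Rightarrow> real"
  assumes "q < 1" and bdd: "\<And>i. i \<in> I \<Longrightarrow> h i \<le> B" and nonneg: "\<And>i. i \<in> I \<Longrightarrow> h i \<ge> 0"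
    and step: "\<And>A i. A \<ge> 0 \<Longrightarrow> (\<And>j. j \<in> I \<Longrightarrow> h j \<le> A) \<Longrightarrow> i \<in> I \<Longrightarrow> h i \<le> a + q * A"
    and "i \<in> I"
  shows "h i \<le> a / (1 - q)"
proof -
  define S where "S = (SUP i\<in>I. h i)"
  have *: "h j \<le> S" if "j \<in> I" for j
    using bdd that unfolding S_def by (intro cSUP_upper bdd_aboveI2)
  have "S \<ge> 0"
    using nonneg[OF \<open>i \<in> I\<close>] *[OF \<open>i \<in> I\<close>] by simp
  then have "S \<le> a + q * S"
    unfolding S_def using \<open>i \<in> I\<close> * by (intro cSUP_least) (auto simp: S_def intro!: step)
  then have "S * (1 - q) \<le> a"
    by (simp add: algebra_simps)
  then have "S \<le> a / (1 - q)"
    using \<open>q < 1\<close> by (simp add: pos_le_divide_eq)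
  then show ?thesis
    using *[OF \<open>i \<in> I\<close>] by simp
qed

lemma set_integrable_continuous_Icc:
  fixes f :: "real \<Rightarrow> 'b::euclidean_space"
  assumes "continuous_on {a..b} f"
  shows "set_integrable lborel {a..b} f"
  using borel_integrable_atLeastAtMost'[OF assms] .

text \<open>A primitive of \<open>C * exp (3 * C * s)\<close> is a third of the weight, and the
  contribution of the endpoint 0 is subtracted.\<close>

lemma set_integral_exp_le:
  fixes C M t :: real
  assumes "C > 0" "M \<ge> 0" "t \<ge> 0"
  shows "(LINT s:{0..t}|lborel. C * (M * exp (3 * C * s))) \<le> M / 3 * exp (3 * C * t)"
proof -
  have "((\<lambda>s. C * (M * exp (3 * C * s))) has_integral M / 3 * exp (3 * C * t) - M / 3 * exp (3 * C * 0)) {0..t}"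
    using assms by (intro fundamental_theorem_of_calculus)
      (auto intro!: derivative_eq_intros simp: has_real_derivative_iff_has_vector_derivative[symmetric])
  moreover have "set_integrable lborel {0..t} (\<lambda>s. C * (M * exp (3 * C * s)))"
    by (intro set_integrable_continuous_Icc continuous_intros)
  ultimately have "(LINT s:{0..t}|lborel. C * (M * exp (3 * C * s))) = M / 3 * exp (3 * C * t) - M / 3 * exp (3 * C * 0)"
    by (metis set_borel_integral_eq_integral(2) integral_unique)
  then show ?thesis
    using assms by simp
qed

text \<open>For the weighted function \<open>h\<close>, a bound \<open>M\<close> improves to
  \<open>a + A / 3 + M / 3\<close>. Absorption with \<open>q = 1 / 3\<close> then yields
  \<open>3 / 2 * (a + A / 3)\<close>; the a priori bound on \<open>h\<close> comes from compactness
  of the interval.\<close>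

lemma weighted_gronwall:
  fixes f :: "real \<Rightarrow> real"
  assumes C: "C > 0" and a: "a \<ge> 0" and A: "A \<ge> 0"
    and cont: "continuous_on {0..T} f" and nonneg: "\<And>t. t \<in> {0..T} \<Longrightarrow> f t \<ge> 0"
    and le: "\<And>t. t \<in> {0..T} \<Longrightarrow> f t \<le> a + (LINT s:{0..t}|lborel. C * (f s + A * exp (3 * C * s)))"
    and t: "t \<in> {0..T}"
  shows "f t \<le> (3 / 2 * a + A / 2) * exp (3 * C * t)"
proof -
  define h where "h t = f t * exp (- 3 * C * t)" for t
  have f_eq: "f t = h t * exp (3 * C * t)" for t
    by (simp add: h_def mult.assoc exp_add[symmetric])
  have "compact (h ` {0..T})"
    unfolding h_def by (intro compact_continuous_image continuous_intros cont) auto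
  then obtain B where B: "\<And>t. t \<in> {0..T} \<Longrightarrow> h t \<le> B"
    by (meson bdd_above.E bounded_imp_bdd_above compact_imp_bounded imageI)
  have "h t \<le> (a + A / 3) / (1 - 1 / 3)"
  proof (rule self_bound[where I="{0..T}" and h=h, OF _ B _ _ t])
    fix M t assume "M \<ge> 0" and M: "\<And>s. s \<in> {0..T} \<Longrightarrow> h s \<le> M" and t: "t \<in> {0..T}"
    have sub: "{0..t} \<subseteq> {0..T}"
      using t by auto
    have "f t \<le> a + (LINT s:{0..t}|lborel. C * (f s + A * exp (3 * C * s)))"
      by (rule le[OF t])
    also have "\<dots> \<le> a + (LINT s:{0..t}|lborel. C * ((M + A) * exp (3 * C * s)))"
    proof (intro add_left_mono set_integral_mono)
      show "set_integrable lborel {0..t} (\<lambda>s. C * (f s + A * exp (3 * C * s)))"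
        "set_integrable lborel {0..t} (\<lambda>s. C * ((M + A) * exp (3 * C * s)))"
        by (intro set_integrable_continuous_Icc continuous_intros continuous_on_subset[OF cont sub])+
      show "C * (f s + A * exp (3 * C * s)) \<le> C * ((M + A) * exp (3 * C * s))" if "s \<in> {0..t}" for s
        using M[of s] that sub C by (auto simp: f_eq algebra_simps)
    qed
    also have "\<dots> \<le> a + (M + A) / 3 * exp (3 * C * t)"
      using C t \<open>M \<ge> 0\<close> A by (intro add_left_mono set_integral_exp_le) auto
    also have "\<dots> \<le> (a + (M + A) / 3) * exp (3 * C * t)"
      using a C t mult_left_mono[of 1 "exp (3 * C * t)" a] by (simp add: algebra_simps)
    finally have "h t \<le> a + (M + A) / 3"
      unfolding f_eq by (simp only: mult_le_cancel_right_pos exp_gt_zero)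
    then show "h t \<le> a + A / 3 + 1 / 3 * M"
      by (simp add: field_simps)
  qed (auto simp: h_def nonneg)
  then show ?thesis
    by (simp add: f_eq)
qed

section \<open>The space of paths and contractions in the weighted norm\<close>

lemma closed_paths: "closed (paths T :: (real \<Rightarrow>\<^sub>C 'a::euclidean_space) set)"
proof -
  have *: "closed {f :: real \<Rightarrow>\<^sub>C 'a. f s = f t}" for s t
    by (rule closed_Collect_eq; rule continuous_on_eval_bcontfun)
  have "paths T = (\<Inter>t\<in>{..0}. {f :: real \<Rightarrow>\<^sub>C 'a. f t = f 0}) \<inter> (\<Inter>t\<in>{T..}. {f :: real \<Rightarrow>\<^sub>C 'a. f t = f T})"
    by (auto simp: paths_def)
  moreover have "closed \<dots>"
    by (rule closed_Int; rule closed_INT; rule ballI; rule *)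
  ultimately show ?thesis
    by (simp only:)
qed

lemma norm_paths_diff_le:
  assumes "x \<in> paths T" "y \<in> paths T" "T \<ge> 0" and le: "\<And>t. t \<in> {0..T} \<Longrightarrow> norm (x t - y t) \<le> c"
  shows "norm (x - y) \<le> c"
proof (rule norm_bound)
  fix t
  have "norm (x t - y t) \<le> c"
  proof -
    \<comment> \<open>A path takes at \<open>t\<close> its value at the projection of
      \<open>t\<close> onto [0,T].\<close>
    have "x t = x (max 0 (min T t))" "y t = y (max 0 (min T t))"
      using assms(1-3) unfolding paths_def mem_Collect_eq by (smt (verit))+
    then show ?thesis
      using le[of "max 0 (min T t)"] \<open>T \<ge> 0\<close> by simp
  qed
  then show "norm ((x - y) t) \<le> c"
    by simp
qed

text \<open>The iterates below converge by the Weierstrass test, which asks for values in a Banach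
  space; norm and completeness are already in place.\<close>

instance bcontfun :: (metric_space, banach) banach ..

text \<open>With a one-point index set \<open>I\<close> this is Picard iteration along a fixed flow; with all inputs as
  indices, and \<open>P\<close> a measurability and moment condition, it yields the McKean-Vlasov fixed point.\<close>

lemma weighted_fixed_point:
  fixes \<Gamma> :: "('i \<Rightarrow> (real \<Rightarrow>\<^sub>C 'a::euclidean_space)) \<Rightarrow> ('i \<Rightarrow> (real \<Rightarrow>\<^sub>C 'a))"
  assumes T: "T \<ge> 0" and C: "C > 0"
    and P: "\<And>X. X \<in> P \<Longrightarrow> \<Gamma> X \<in> P" "\<And>X i. X \<in> P \<Longrightarrow> i \<in> I \<Longrightarrow> X i \<in> paths T"
    and P_lim: "\<And>X L. (\<And>n. X n \<in> P) \<Longrightarrow> uniform_limit I X L sequentially \<Longrightarrow> L \<in> P"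
    and Z: "Z \<in> P"
    and Z_bdd: "\<And>i t. i \<in> I \<Longrightarrow> t \<in> {0..T} \<Longrightarrow> norm (\<Gamma> Z i t - Z i t) \<le> B"
    and contr: "\<And>X Y A i t. X \<in> P \<Longrightarrow> Y \<in> P \<Longrightarrow> A \<ge> 0 \<Longrightarrow>
      (\<And>i t. i \<in> I \<Longrightarrow> t \<in> {0..T} \<Longrightarrow> norm (X i t - Y i t) \<le> A * exp (3 * C * t)) \<Longrightarrow>
      i \<in> I \<Longrightarrow> t \<in> {0..T} \<Longrightarrow> norm (\<Gamma> X i t - \<Gamma> Y i t) \<le> A / 2 * exp (3 * C * t)"
  shows "\<exists>X\<in>P. \<forall>i\<in>I. \<Gamma> X i = X i"
proof -
  define x where "x n = (\<Gamma> ^^ n) Z" for n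
  define D where "D = max B 0"
  have x_Suc: "x (Suc n) = \<Gamma> (x n)" for n
    by (simp add: x_def)
  have x_P: "x n \<in> P" for n
    by (induction n) (auto simp: x_def Z P(1))
  have step: "norm (x (Suc n) i t - x n i t) \<le> D / 2 ^ n * exp (3 * C * t)" if "i \<in> I" "t \<in> {0..T}" for n i t
    using that
  proof (induction n arbitrary: i t)
    case 0
    have "D * 1 \<le> D * exp (3 * C * t)"
      using C 0 by (intro mult_left_mono) (auto simp: D_def)
    then show ?case
      using Z_bdd[OF 0] by (simp add: x_def D_def)
  next
    case (Suc n)
    have "norm (\<Gamma> (x (Suc n)) i t - \<Gamma> (x n) i t) \<le> D / 2 ^ n / 2 * exp (3 * C * t)"
      by (rule contr) (use Suc x_P in \<open>auto simp: D_def\<close>)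
    then show ?case
      by (simp add: x_Suc field_simps)
  qed
  have exp_le: "A * exp (3 * C * t) \<le> A * exp (3 * C * T)" if "t \<in> {0..T}" "A \<ge> 0" for t A
    using that C by (intro mult_left_mono) auto
  have norm_step: "norm (x (Suc n) i - x n i) \<le> D / 2 ^ n * exp (3 * C * T)" if "i \<in> I" for n i
    using T that by (intro norm_paths_diff_le[of _ T] P(2) x_P order.trans[OF step exp_le]) (auto simp: D_def)
  have "summable (\<lambda>n. D / 2 ^ n * exp (3 * C * T))"
    using summable_mult[OF summable_geometric[of "1 / 2 :: real"], of "D * exp (3 * C * T)"]
    by (simp add: power_one_over field_simps)
  with norm_step have "uniform_limit I (\<lambda>n i. \<Sum>k<n. x (Suc k) i - x k i) (\<lambda>i. \<Sum>k. x (Suc k) i - x k i) sequentially"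
    by (rule Weierstrass_m_test)
  then have "uniform_limit I (\<lambda>n i. (\<Sum>k<n. x (Suc k) i - x k i) + x 0 i) (\<lambda>i. (\<Sum>k. x (Suc k) i - x k i) + x 0 i) sequentially"
    by (intro uniform_limit_add uniform_limit_const)
  moreover have "(\<Sum>k<n. x (Suc k) i - x k i) + x 0 i = x n i" for n i
    by (subst sum_lessThan_telescope) simp
  ultimately obtain L where L: "uniform_limit I x L sequentially"
    by (auto simp: fun_eq_iff)
  have L_P: "L \<in> P"
    using P_lim[OF x_P L] .
  have "\<Gamma> L i = L i" if i: "i \<in> I" for i
  proof -
    have "(\<lambda>n. x (Suc n) i) \<longlonglongrightarrow> \<Gamma> L i"
    proof (rule tendstoI)
      fix e :: real assume "e > 0"
      \<comment> \<open>Continuity of \<open>\<Gamma>\<close> at \<open>L\<close> is again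
        \<open>contr\<close>: the weight is at least 1, so uniform distance below \<open>d\<close>
        is a weighted bound by \<open>d\<close>. With this \<open>d\<close> the resulting bound
        \<open>d / 2 * exp (3 * C * T)\<close> equals \<open>e / 2\<close>.\<close>
      define d where "d = e / exp (3 * C * T)"
      have "d > 0"
        using \<open>e > 0\<close> by (simp add: d_def)
      from uniform_limitD[OF L this] show "\<forall>\<^sub>F n in sequentially. dist (x (Suc n) i) (\<Gamma> L i) < e"
      proof eventually_elim
        case (elim n)
        have "norm (x n j t - L j t) \<le> d * exp (3 * C * t)" if "j \<in> I" "t \<in> {0..T}" for j t
        proof -
          have "norm (x n j t - L j t) \<le> d * 1"
            using elim that(1) dist_fun_lt_imp_dist_val_lt[of "x n j" "L j" d t] by (auto simp: dist_norm)
          also have "\<dots> \<le> d * exp (3 * C * t)"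
            using C that \<open>d > 0\<close> by (intro mult_left_mono) auto
          finally show ?thesis .
        qed
        then have "norm (\<Gamma> (x n) i t - \<Gamma> L i t) \<le> d / 2 * exp (3 * C * T)" if "t \<in> {0..T}" for t
          using that i \<open>d > 0\<close> by (intro order.trans[OF contr[OF x_P L_P] exp_le]) auto
        then have "norm (x (Suc n) i - \<Gamma> L i) \<le> d / 2 * exp (3 * C * T)"
          unfolding x_Suc using i T by (intro norm_paths_diff_le[of _ T] P x_P L_P)
        also have "\<dots> < e"
          using \<open>e > 0\<close> by (simp add: d_def)
        finally show ?case
          by (simp add: dist_norm)
      qed
    qed
    moreover have "(\<lambda>n. x (Suc n) i) \<longlonglongrightarrow> L i"
      using tendsto_uniform_limitI[OF L i] by (rule LIMSEQ_Suc)
    ultimately show ?thesis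
      by (rule LIMSEQ_unique)
  qed
  then show ?thesis
    using L_P by blast
qed

subsection \<open>Path-valued random variables and their marginals\<close>

text \<open>Composition with the projection onto [0,T] gives the constant extension that
  \<open>paths\<close> requires. \<open>Bcontfun\<close> is meaningful only on bounded continuous
  functions, whence the continuity assumption in \<open>extend_path_apply\<close>.\<close>

definition extend_path :: "real \<Rightarrow> (real \<Rightarrow> 'a::euclidean_space) \<Rightarrow> (real \<Rightarrow>\<^sub>C 'a)" where
  "extend_path T G = Bcontfun (\<lambda>t. G (max 0 (min T t)))"

lemma extend_path_apply:
  assumes "continuous_on {0..T} G" "T \<ge> 0"
  shows "extend_path T G t = G (max 0 (min T t))"
proof -
  have "bounded (range (\<lambda>t. G (max 0 (min T t))))"
    using compact_imp_bounded[OF compact_continuous_image[OF assms(1) compact_Icc]]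
    by (rule bounded_subset) (use assms(2) in auto)
  moreover have "continuous_on UNIV (\<lambda>t. G (max 0 (min T t)))"
    by (rule continuous_on_compose2[OF assms(1)]) (use assms(2) in \<open>auto intro!: continuous_intros\<close>)
  ultimately show ?thesis
    by (simp add: extend_path_def Bcontfun_inverse bcontfun_def)
qed

lemma extend_path_in_paths:
  assumes "continuous_on {0..T} G" "T \<ge> 0"
  shows "extend_path T G \<in> paths T"
  using assms by (auto simp: paths_def extend_path_apply)

lemma continuous_on_set_integral:
  fixes f :: "real \<Rightarrow> 'a::euclidean_space"
  assumes "set_integrable lborel {0..T} f"
  shows "continuous_on {0..T} (\<lambda>t. LINT s:{0..t}|lborel. f s)"
proof -
  have "(LINT s:{0..t}|lborel. f s) = integral {0..t} f" if "t \<in> {0..T}" for t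
    using that by (intro set_borel_integral_eq_integral set_integrable_subset[OF assms]) auto
  then show ?thesis
    using indefinite_integral_continuous_1[OF set_borel_integral_eq_integral(1)[OF assms]]
    by (subst continuous_on_cong[OF refl])
qed

lemma distr_in_wspace:
  assumes "prob_space N" "X \<in> N \<rightarrow>\<^sub>M borel_on E" "(\<integral>\<^sup>+ \<omega>. ennreal (norm (X \<omega>) powr p) \<partial>N) < \<infinity>"
  shows "distr N (borel_on E) X \<in> wspace p E"
proof -
  note [measurable] = norm_measurable_borel_on[of E] assms(2)
  show ?thesis
    using assms unfolding wspace_def
    by (auto simp: nn_integral_distr intro!: prob_space.prob_space_distr)
qed

lemma marginal_in_wspace:
  assumes p: "p \<ge> 1" and \<mu>: "\<mu> \<in> wspace p (paths T)"
  shows "marginal \<mu> t \<in> wspace p UNIV" and "moment p (marginal \<mu> t) \<le> moment p \<mu>"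
proof -
  have [measurable_cong]: "sets \<mu> = sets (borel_on (paths T))"
    using \<mu> by (simp add: wspace_def)
  have le: "(\<integral>\<^sup>+ \<gamma>. ennreal (norm (apply_bcontfun \<gamma> t) powr p) \<partial>\<mu>) \<le> ennreal (moment p \<mu>)"
    unfolding nn_integral_moment[OF \<mu>, symmetric]
    using p by (intro nn_integral_mono ennreal_leI powr_mono2) (auto intro: norm_bounded)
  have "distr \<mu> (borel_on UNIV) (\<lambda>\<gamma>. apply_bcontfun \<gamma> t) \<in> wspace p UNIV"
    using \<mu> by (intro distr_in_wspace) (auto simp: wspace_def intro: le_less_trans[OF le])
  then show *: "marginal \<mu> t \<in> wspace p UNIV"
    by (simp add: marginal_def)
  have "(\<integral>\<^sup>+ x. ennreal (norm x powr p) \<partial>marginal \<mu> t) \<le> ennreal (moment p \<mu>)"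
    using le by (simp add: marginal_def nn_integral_distr)
  then show "moment p (marginal \<mu> t) \<le> moment p \<mu>"
    using nn_integral_moment[OF *] by simp
qed

text \<open>Both marginals are read off the same random path. The cost of this coupling tends to 0
  path by path, and \<open>2 powr p * norm \<gamma> powr p\<close> is an integrable dominating
  function.\<close>

lemma marginal_continuous:
  assumes p: "p \<ge> 1" and \<mu>: "\<mu> \<in> wspace p (paths T)" and s: "s \<longlonglongrightarrow> t"
  shows "(\<lambda>n. wasserstein p (marginal \<mu> t) (marginal \<mu> (s n)) powr p) \<longlonglongrightarrow> 0"
proof -
  have [measurable_cong]: "sets \<mu> = sets (borel_on (paths T))" and prob: "prob_space \<mu>"
    using \<mu> by (auto simp: wspace_def)
  note [measurable] = wspace_norm_measurable[OF \<mu>]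
  define I where "I n = (\<integral>\<^sup>+ \<gamma>. ennreal (norm (apply_bcontfun \<gamma> t - apply_bcontfun \<gamma> (s n)) powr p) \<partial>\<mu>)" for n
  have le: "norm (apply_bcontfun \<gamma> t - apply_bcontfun \<gamma> (s n)) powr p \<le> 2 powr p * norm \<gamma> powr p" for \<gamma> :: "real \<Rightarrow>\<^sub>C 'a" and n
  proof -
    have "norm (apply_bcontfun \<gamma> t - apply_bcontfun \<gamma> (s n)) \<le> 2 * norm \<gamma>"
      using norm_triangle_ineq4[of "apply_bcontfun \<gamma> t" "apply_bcontfun \<gamma> (s n)"] norm_bounded[of \<gamma> t] norm_bounded[of \<gamma> "s n"] by simp
    then have "norm (apply_bcontfun \<gamma> t - apply_bcontfun \<gamma> (s n)) powr p \<le> (2 * norm \<gamma>) powr p"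
      using p by (intro powr_mono2) auto
    then show ?thesis
      by (simp add: powr_mult)
  qed
  have bound: "(\<integral>\<^sup>+ \<gamma>. ennreal (2 powr p * norm \<gamma> powr p) \<partial>\<mu>) = ennreal (2 powr p * moment p \<mu>)"
    using nn_integral_moment[OF \<mu>] by (simp add: ennreal_mult nn_integral_cmult)
  have "I \<longlonglongrightarrow> (\<integral>\<^sup>+ \<gamma>. 0 \<partial>\<mu>)"
    unfolding I_def
  proof (rule nn_integral_dominated_convergence[where w="\<lambda>\<gamma>. ennreal (2 powr p * norm \<gamma> powr p)"])
    show "AE \<gamma> in \<mu>. (\<lambda>n. ennreal (norm (apply_bcontfun \<gamma> t - apply_bcontfun \<gamma> (s n)) powr p)) \<longlonglongrightarrow> 0"
    proof (intro AE_I2)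
      fix \<gamma> :: "real \<Rightarrow>\<^sub>C 'a"
      have "(\<lambda>n. apply_bcontfun \<gamma> (s n)) \<longlonglongrightarrow> apply_bcontfun \<gamma> t"
        by (rule continuous_on_tendsto_compose[OF continuous_on_apply_bcontfun[of UNIV] s]) auto
      then have "(\<lambda>n. norm (apply_bcontfun \<gamma> t - apply_bcontfun \<gamma> (s n))) \<longlonglongrightarrow> norm (apply_bcontfun \<gamma> t - apply_bcontfun \<gamma> t)"
        by (intro tendsto_intros)
      then have "(\<lambda>n. norm (apply_bcontfun \<gamma> t - apply_bcontfun \<gamma> (s n)) powr p) \<longlonglongrightarrow> 0"
        using p by (intro tendsto_zero_powrI[OF _ tendsto_const]) auto
      then show "(\<lambda>n. ennreal (norm (apply_bcontfun \<gamma> t - apply_bcontfun \<gamma> (s n)) powr p)) \<longlonglongrightarrow> 0"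
        using tendsto_ennrealI by fastforce
    qed
    show "AE \<gamma> in \<mu>. ennreal (norm (apply_bcontfun \<gamma> t - apply_bcontfun \<gamma> (s n)) powr p)
        \<le> ennreal (2 powr p * norm \<gamma> powr p)" for n
      by (intro AE_I2 ennreal_leI le)
  qed (auto simp: bound)
  then have "(\<lambda>n. enn2real (I n)) \<longlonglongrightarrow> enn2real 0"
    by (intro tendsto_enn2real) auto
  then have lim: "(\<lambda>n. enn2real (I n)) \<longlonglongrightarrow> 0"
    by simp
  have "wasserstein p (marginal \<mu> t) (marginal \<mu> (s n)) powr p \<le> enn2real (I n)" for n
  proof -
    have "I n \<le> ennreal (2 powr p * moment p \<mu>)"
      unfolding I_def bound[symmetric] using le by (intro nn_integral_mono ennreal_leI)
    then have "I n < \<infinity>"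
      by (rule le_less_trans) simp
    then have "wasserstein p (distr \<mu> (borel_on UNIV) (\<lambda>\<gamma>. apply_bcontfun \<gamma> t)) (distr \<mu> (borel_on UNIV) (\<lambda>\<gamma>. apply_bcontfun \<gamma> (s n))) powr p \<le> enn2real (I n)"
      using p prob by (intro wasserstein_distr_powr_le diff_measurable_UNIV) (auto simp: I_def)
    then show ?thesis
      by (simp add: marginal_def)
  qed
  then show ?thesis
    by (intro Lim_null_comparison[OF always_eventually lim]) simp_all
qed

text \<open>Since \<open>wborel\<close> is generated by the Wasserstein-open sets, continuity of the
  flow suffices. Composed with the jointly measurable drift, this makes
  \<open>b s (x s) (marginal \<mu> s)\<close> measurable in \<open>s\<close>.\<close>

lemma marginal_measurable:
  assumes p: "p \<ge> 1" and \<mu>: "\<mu> \<in> wspace p (paths T)"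
  shows "marginal \<mu> \<in> borel \<rightarrow>\<^sub>M wborel p UNIV"
  unfolding wborel_def
proof (rule measurable_measure_of)
  show "marginal \<mu> \<in> space borel \<rightarrow> wspace p UNIV"
    using marginal_in_wspace[OF p \<mu>] by auto
  fix U :: "'a measure set"
  assume "U \<in> {U. U \<subseteq> wspace p UNIV \<and> (\<forall>\<mu>\<in>U. \<exists>\<epsilon>>0. \<forall>\<nu>\<in>wspace p UNIV. wasserstein p \<mu> \<nu> < \<epsilon> \<longrightarrow> \<nu> \<in> U)}"
  then have U: "\<And>\<mu>. \<mu> \<in> U \<Longrightarrow> \<exists>\<epsilon>>0. \<forall>\<nu>\<in>wspace p UNIV. wasserstein p \<mu> \<nu> < \<epsilon> \<longrightarrow> \<nu> \<in> U"
    by blast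
  have "open (marginal \<mu> -` U)"
    unfolding open_subopen[of "marginal \<mu> -` U"]
  proof
    fix t assume t: "t \<in> marginal \<mu> -` U"
    then obtain e where e: "e > 0" "\<And>\<nu>. \<nu> \<in> wspace p UNIV \<Longrightarrow> wasserstein p (marginal \<mu> t) \<nu> < e \<Longrightarrow> \<nu> \<in> U"
      using U by (meson vimageE)
    \<comment> \<open>Intersecting with \<open>principal UNIV\<close> leaves \<open>nhds t\<close>
      unchanged and brings the goal into the form of the sequential criterion.\<close>
    have "eventually (\<lambda>r. marginal \<mu> r \<in> U) (inf (nhds t) (principal UNIV))"
    proof (rule sequentially_imp_eventually_nhds_within, intro allI impI)
      fix s :: "nat \<Rightarrow> real" assume "(\<forall>n. s n \<in> UNIV) \<and> s \<longlonglongrightarrow> t"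
      then have "s \<longlonglongrightarrow> t"
        by simp
      then have "\<forall>\<^sub>F n in sequentially. wasserstein p (marginal \<mu> t) (marginal \<mu> (s n)) powr p < e powr p"
        using e(1) by (intro order_tendstoD(2)[OF marginal_continuous[OF p \<mu>]]) auto
      then show "\<forall>\<^sub>F n in sequentially. marginal \<mu> (s n) \<in> U"
      proof eventually_elim
        case (elim n)
        then have "wasserstein p (marginal \<mu> t) (marginal \<mu> (s n)) < e"
          using p e(1) powr_mono2[of p e "wasserstein p (marginal \<mu> t) (marginal \<mu> (s n))"] by force
        then show ?case
          by (intro e(2) marginal_in_wspace[OF p \<mu>])
      qed
    qed
    then show "\<exists>S. open S \<and> t \<in> S \<and> S \<subseteq> marginal \<mu> -` U"
      by (auto simp: eventually_nhds subset_eq)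
  qed
  then show "marginal \<mu> -` U \<inter> space borel \<in> sets borel"
    by simp
qed auto

section \<open>Finite moments\<close>

lemma return_in_wspace: "return borel 0 \<in> wspace p (UNIV :: 'a::euclidean_space set)"
  by (auto simp: wspace_def nn_integral_return intro: prob_space_return)

lemma moment_return [simp]: "moment p (return borel (0 :: 'a::euclidean_space)) = 0"
  by (simp add: moment_def nn_integral_return)

lemma space_wspace:
  assumes "\<mu> \<in> wspace p E"
  shows "space \<mu> = E"
  using assms sets_eq_imp_space_eq[of \<mu> "borel_on E"] by (simp add: wspace_def)

text \<open>Affine growth is how finite moments pass from inputs to solutions and from iterates to
  their limit. The bound is stated almost everywhere because a solution of the McKean-Vlasov
  equation obeys its equation only almost surely.\<close>

lemma nn_integral_affine_powr_finite:
  assumes p: "p \<ge> 1" and "prob_space N" and h[measurable]: "h \<in> borel_measurable N"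
    and nonneg: "a \<ge> 0" "c \<ge> 0" "\<And>\<omega>. h \<omega> \<ge> 0" "\<And>\<omega>. u \<omega> \<ge> 0"
    and fin: "(\<integral>\<^sup>+ \<omega>. ennreal (h \<omega> powr p) \<partial>N) < \<infinity>"
    and le: "AE \<omega> in N. u \<omega> \<le> a + c * h \<omega>"
  shows "(\<integral>\<^sup>+ \<omega>. ennreal (u \<omega> powr p) \<partial>N) < \<infinity>"
proof -
  interpret prob_space N by fact
  have "u \<omega> powr p \<le> 2 powr (p - 1) * a powr p + 2 powr (p - 1) * c powr p * h \<omega> powr p"
    if "u \<omega> \<le> a + c * h \<omega>" for \<omega>
  proof -
    have "u \<omega> powr p \<le> (a + c * h \<omega>) powr p"
      using p nonneg that by (intro powr_mono2) auto
    also have "\<dots> \<le> 2 powr (p - 1) * (a powr p + (c * h \<omega>) powr p)"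
      using p nonneg by (intro add_powr_le) auto
    finally show ?thesis
      using nonneg by (simp add: powr_mult algebra_simps)
  qed
  then have "(\<integral>\<^sup>+ \<omega>. ennreal (u \<omega> powr p) \<partial>N)
      \<le> (\<integral>\<^sup>+ \<omega>. ennreal (2 powr (p - 1) * a powr p) + ennreal (2 powr (p - 1) * c powr p) * ennreal (h \<omega> powr p) \<partial>N)"
    using le by (intro nn_integral_mono_AE)
      (auto simp: ennreal_mult[symmetric] ennreal_plus[symmetric] simp del: ennreal_plus intro!: ennreal_leI)
  also have "\<dots> = ennreal (2 powr (p - 1) * a powr p)
      + ennreal (2 powr (p - 1) * c powr p) * (\<integral>\<^sup>+ \<omega>. ennreal (h \<omega> powr p) \<partial>N)"
    by (simp add: nn_integral_add nn_integral_cmult emeasure_space_1)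
  also have "\<dots> < \<infinity>"
    using fin by (simp add: ennreal_mult_less_top)
  finally show ?thesis .
qed

lemma norm_add_norm_le_norm_Pair: "norm (fst z) + norm (snd z) \<le> 2 * norm z"
  using norm_fst_le[of "fst z" "snd z"] norm_snd_le[of "snd z" "fst z"] by simp

lemma input_law_in_wspace:
  assumes p: "p \<ge> 1" and L: "Lp_input T p M \<zeta> W"
  shows "input_law T M \<zeta> W \<in> wspace p (inputs T)"
  unfolding input_law_def
proof (rule distr_in_wspace)
  have Z: "(\<lambda>\<omega>. (\<zeta> \<omega>, W \<omega>)) \<in> M \<rightarrow>\<^sub>M borel_on (inputs T)"
    using L by (simp add: Lp_input_def)
  \<comment> \<open>The components of the pair are measurable because the coordinate projections are
    continuous for the product topology behind \<open>borel_on (inputs T)\<close>.\<close>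
  have [measurable]: "(\<lambda>\<omega>. norm (\<zeta> \<omega>)) \<in> borel_measurable M" "(\<lambda>\<omega>. norm (W \<omega>)) \<in> borel_measurable M"
    using measurable_compose[OF Z measurable_borel_onI[OF continuous_on_norm[OF continuous_on_fst[OF continuous_on_id]]]]
      measurable_compose[OF Z measurable_borel_onI[OF continuous_on_norm[OF continuous_on_snd[OF continuous_on_id]]]]
    by simp_all
  have "norm (\<zeta> \<omega>, W \<omega>) powr p \<le> 2 powr (p - 1) * (norm (\<zeta> \<omega>) powr p + norm (W \<omega>) powr p)" for \<omega>
    using p by (intro order.trans[OF powr_mono2 add_powr_le]) (auto intro: norm_Pair_le)
  then have "(\<integral>\<^sup>+ \<omega>. ennreal (norm (\<zeta> \<omega>, W \<omega>) powr p) \<partial>M) \<le>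
      (\<integral>\<^sup>+ \<omega>. ennreal (2 powr (p - 1)) * (ennreal (norm (\<zeta> \<omega>) powr p) + ennreal (norm (W \<omega>) powr p)) \<partial>M)"
    by (intro nn_integral_mono) (auto simp: ennreal_mult[symmetric] ennreal_plus[symmetric] simp del: ennreal_plus intro!: ennreal_leI)
  also have "\<dots> = ennreal (2 powr (p - 1)) *
      ((\<integral>\<^sup>+ \<omega>. ennreal (norm (\<zeta> \<omega>) powr p) \<partial>M) + (\<integral>\<^sup>+ \<omega>. ennreal (norm (W \<omega>) powr p) \<partial>M))"
    by (simp add: nn_integral_add nn_integral_cmult)
  also have "\<dots> < \<infinity>"
    using L by (simp add: Lp_input_def ennreal_mult_less_top)
  finally show "(\<integral>\<^sup>+ \<omega>. ennreal (norm (\<zeta> \<omega>, W \<omega>) powr p) \<partial>M) < \<infinity>" .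
qed (use L in \<open>auto simp: Lp_input_def\<close>)

lemma diff_measurable_inputs: "diff_measurable (inputs T)"
  by (intro diff_measurable_Times diff_measurable_UNIV diff_measurable_bcontfun)

subsection \<open>Equations along a given flow of marginals\<close>

text \<open>The Lipschitz condition compares values of \<open>b\<close> at equal times only and says
  nothing about growth in time: the one-dimensional drift \<open>1 / t\<close> satisfies it with
  \<open>K = 0\<close>, yet is not integrable near 0. Integrability at the reference point, the
  origin together with the point mass there, is what \<open>int0\<close> provides.\<close>

locale mkv_drift =
  fixes T p K :: real and b :: "'a::euclidean_space drift"
  assumes T: "T > 0" and p: "p \<ge> 1"
    and meas: "(\<lambda>(t, x, \<mu>). b t x \<mu>) \<in> borel_on {0..T} \<Otimes>\<^sub>M (borel \<Otimes>\<^sub>M wborel p UNIV) \<rightarrow>\<^sub>M borel"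
    and lip: "\<And>t x x' \<mu> \<mu>'. t \<in> {0..T} \<Longrightarrow> \<mu> \<in> wspace p UNIV \<Longrightarrow> \<mu>' \<in> wspace p UNIV \<Longrightarrow>
        norm (b t x \<mu> - b t x' \<mu>') powr p
          \<le> K * (norm (x - x') powr p + wasserstein p \<mu> \<mu>' powr p)"
    and int0: "set_integrable lborel {0..T} (\<lambda>t. b t 0 (return borel 0))"
begin

text \<open>The p-th root of the Lipschitz constant. \<open>max\<close> is there because no sign of
  \<open>K\<close> is assumed, and the summand 1 makes \<open>C\<close> strictly positive, as the
  exponential weight requires.\<close>

definition C :: real where
  "C = max K 0 powr (1 / p) + 1"

lemma C_pos: "C > 0"
  by (simp add: C_def add_nonneg_pos)

text \<open>Taking p-th roots, by superadditivity of the p-th power, gives a bound linear in both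
  distances, the form that the Gronwall argument uses.\<close>

lemma drift_lipschitz:
  assumes "t \<in> {0..T}" "\<mu> \<in> wspace p UNIV" "\<mu>' \<in> wspace p UNIV"
  shows "norm (b t x \<mu> - b t x' \<mu>') \<le> C * (norm (x - x') + wasserstein p \<mu> \<mu>')"
proof -
  let ?N = "norm (b t x \<mu> - b t x' \<mu>')" and ?u = "norm (x - x')" and ?w = "wasserstein p \<mu> \<mu>'"
  have "?N powr p \<le> K * (?u powr p + ?w powr p)"
    by (rule lip[OF assms])
  also have "\<dots> \<le> max K 0 * (?u + ?w) powr p"
    using p by (intro mult_mono powr_add_le_add_powr) auto
  finally have "(?N powr p) powr (1 / p) \<le> (max K 0 * (?u + ?w) powr p) powr (1 / p)"
    using p by (intro powr_mono2) auto
  then have "?N \<le> max K 0 powr (1 / p) * (?u + ?w)"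
    using p by (simp add: powr_powr powr_mult)
  also have "\<dots> \<le> C * (?u + ?w)"
    by (intro mult_right_mono) (auto simp: C_def)
  finally show ?thesis .
qed

lemma stability:
  assumes x: "solves_along T b m x0 g x" and y: "solves_along T b m' y0 g' y"
    and m: "\<And>s. s \<in> {0..T} \<Longrightarrow> m s \<in> wspace p UNIV" and m': "\<And>s. s \<in> {0..T} \<Longrightarrow> m' s \<in> wspace p UNIV"
    and A: "A \<ge> 0" and W: "\<And>s. s \<in> {0..T} \<Longrightarrow> wasserstein p (m s) (m' s) \<le> A * exp (3 * C * s)"
    and t: "t \<in> {0..T}"
  shows "norm (x t - y t) \<le> (3 / 2 * (norm (x0 - y0) + norm (g - g')) + A / 2) * exp (3 * C * t)"
proof (rule weighted_gronwall[OF C_pos _ A _ _ _ t])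
  show "continuous_on {0..T} (\<lambda>t. norm (x t - y t))"
    by (intro continuous_intros) auto
  fix t assume t: "t \<in> {0..T}"
  let ?F = "\<lambda>s. b s (x s) (m s)" and ?G = "\<lambda>s. b s (y s) (m' s)"
  have sub: "{0..t} \<subseteq> {0..T}"
    using t by auto
  have int: "set_integrable lborel {0..t} ?F" "set_integrable lborel {0..t} ?G"
    using x y t by (auto simp: solves_along_def intro!: set_integrable_subset[OF _ _ sub])
  have "x t - y t = (x0 - y0) + (g - g') t + (LINT s:{0..t}|lborel. ?F s - ?G s)"
    using x y t int by (simp add: solves_along_def set_integral_diff)
  then have "norm (x t - y t) \<le> norm (x0 - y0) + norm ((g - g') t) + norm (LINT s:{0..t}|lborel. ?F s - ?G s)"
    by (simp only:) (intro norm_triangle_le add_right_mono norm_triangle_ineq)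
  also have "norm ((g - g') t) \<le> norm (g - g')"
    by (rule norm_bounded)
  also have "norm (LINT s:{0..t}|lborel. ?F s - ?G s) \<le> (LINT s:{0..t}|lborel. norm (?F s - ?G s))"
    using int by (intro set_integral_norm_bound set_integral_diff)
  also have "\<dots> \<le> (LINT s:{0..t}|lborel. C * (norm (x s - y s) + A * exp (3 * C * s)))"
  proof (rule set_integral_mono)
    show "set_integrable lborel {0..t} (\<lambda>s. norm (?F s - ?G s))"
      using int by (intro set_integrable_norm set_integral_diff)
    show "set_integrable lborel {0..t} (\<lambda>s. C * (norm (x s - y s) + A * exp (3 * C * s)))"
      by (intro set_integrable_continuous_Icc continuous_intros) auto
    fix s assume "s \<in> {0..t}"
    then have s: "s \<in> {0..T}"
      using sub by blast
    have "norm (?F s - ?G s) \<le> C * (norm (x s - y s) + wasserstein p (m s) (m' s))"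
      by (intro drift_lipschitz s m m')
    also have "\<dots> \<le> C * (norm (x s - y s) + A * exp (3 * C * s))"
      using C_pos W[OF s] by (intro mult_left_mono add_left_mono) auto
    finally show "norm (?F s - ?G s) \<le> C * (norm (x s - y s) + A * exp (3 * C * s))" .
  qed
  finally show "norm (x t - y t) \<le> norm (x0 - y0) + norm (g - g') + (LINT s:{0..t}|lborel. C * (norm (x s - y s) + A * exp (3 * C * s)))"
    by simp
qed auto

text \<open>The flow is an arbitrary family in \<open>wspace p UNIV\<close>: in
  \<open>mkv_solution_eq_sol_map\<close> this is applied to the marginals of a law whose
  supremum-norm moment is not yet known to be finite.\<close>

lemma stability_same_flow:
  assumes x: "solves_along T b m x0 g x" and y: "solves_along T b m y0 g' y"
    and m: "\<And>s. s \<in> {0..T} \<Longrightarrow> m s \<in> wspace p UNIV"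
  shows "norm (x - y) \<le> 3 / 2 * (norm (x0 - y0) + norm (g - g')) * exp (3 * C * T)"
proof (rule norm_paths_diff_le[of _ T])
  fix t assume t: "t \<in> {0..T}"
  have "norm (x t - y t) \<le> (3 / 2 * (norm (x0 - y0) + norm (g - g')) + 0 / 2) * exp (3 * C * t)"
    using p by (intro stability[OF x y m m _ _ t]) (auto simp: wasserstein_self[OF m diff_measurable_UNIV])
  also have "\<dots> \<le> (3 / 2 * (norm (x0 - y0) + norm (g - g')) + 0 / 2) * exp (3 * C * T)"
    using C_pos t by (intro mult_left_mono) auto
  finally show "norm (x t - y t) \<le> 3 / 2 * (norm (x0 - y0) + norm (g - g')) * exp (3 * C * T)"
    by simp
qed (use T x y in \<open>auto simp: solves_along_def\<close>)

lemma solves_along_unique: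
  assumes "solves_along T b m x0 g x" "solves_along T b m x0 g y" "\<And>s. s \<in> {0..T} \<Longrightarrow> m s \<in> wspace p UNIV"
  shows "x = y"
  using stability_same_flow[OF assms] by simp

text \<open>Growth relative to the reference point: the drift differs from the integrable
  \<open>b s 0 (return borel 0)\<close> by at most \<open>C * (norm x + R)\<close>, uniformly in
  \<open>s\<close>.\<close>

lemma drift_set_integrable:
  fixes x :: "real \<Rightarrow>\<^sub>C 'a"
  assumes \<mu>: "\<mu> \<in> wspace p (paths T)"
  shows "set_integrable lborel {0..T} (\<lambda>s. b s (x s) (marginal \<mu> s))"
proof -
  \<comment> \<open>Bounds the distance of every marginal to the point mass at 0; the summand 0 is
    the moment of that point mass.\<close>
  define R where "R = (2 powr (p - 1) * (moment p \<mu> + 0)) powr (1 / p)"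
  have W: "wasserstein p (marginal \<mu> s) (return borel 0) \<le> R" for s
  proof -
    have "wasserstein p (marginal \<mu> s) (return borel 0) powr p \<le> 2 powr (p - 1) * (moment p (marginal \<mu> s) + moment p (return borel (0 :: 'a)))"
      by (intro wasserstein_powr_le_moment[OF p marginal_in_wspace(1)[OF p \<mu>] return_in_wspace])
    also have "\<dots> \<le> 2 powr (p - 1) * (moment p \<mu> + 0)"
      using marginal_in_wspace(2)[OF p \<mu>] by simp
    finally have "(wasserstein p (marginal \<mu> s) (return borel 0) powr p) powr (1 / p) \<le> R"
      unfolding R_def using p by (intro powr_mono2) auto
    then show ?thesis
      using p by (simp add: powr_powr)
  qed
  have "(\<lambda>s. (s, apply_bcontfun x s, marginal \<mu> s)) \<in> borel_on {0..T} \<rightarrow>\<^sub>M borel_on {0..T} \<Otimes>\<^sub>M (borel \<Otimes>\<^sub>M wborel p UNIV)"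
  proof -
    have "apply_bcontfun x \<in> borel_on {0..T} \<rightarrow>\<^sub>M borel"
      by (intro measurable_borel_onI) auto
    moreover have "marginal \<mu> \<in> borel_on {0..T} \<rightarrow>\<^sub>M wborel p UNIV"
      unfolding borel_on_def by (intro measurable_restrict_space1 marginal_measurable[OF p \<mu>])
    ultimately show ?thesis
      by measurable
  qed
  from measurable_compose[OF this meas]
  have "(\<lambda>s. b s (x s) (marginal \<mu> s)) \<in> borel_on {0..T} \<rightarrow>\<^sub>M borel"
    by simp
  then have "set_borel_measurable lborel {0..T} (\<lambda>s. b s (x s) (marginal \<mu> s))"
    by (simp add: borel_on_def borel_measurable_restrict_space_iff set_borel_measurable_def)
  moreover have "set_integrable lborel {0..T} (\<lambda>s. norm (b s 0 (return borel 0)) + C * (norm x + R))"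
    by (rule set_integral_add(1)[OF set_integrable_norm[OF int0]])
      (intro set_integrable_continuous_Icc continuous_intros)
  moreover have "norm (b s (x s) (marginal \<mu> s)) \<le> norm (norm (b s 0 (return borel 0)) + C * (norm x + R))" if "s \<in> {0..T}" for s
  proof -
    have "norm (b s (x s) (marginal \<mu> s) - b s 0 (return borel 0)) \<le> C * (norm (x s - 0) + wasserstein p (marginal \<mu> s) (return borel 0))"
      by (intro drift_lipschitz that marginal_in_wspace[OF p \<mu>] return_in_wspace)
    also have "\<dots> \<le> C * (norm x + R)"
      using C_pos W norm_bounded[of x s] by (intro mult_left_mono add_mono) auto
    finally show ?thesis
      using norm_triangle_ineq2[of "b s (x s) (marginal \<mu> s)" "b s 0 (return borel 0)"] by simp
  qed
  ultimately show ?thesis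
    by (blast intro: set_integrable_bound AE_I2)
qed

text \<open>Along a frozen flow two drift terms differ only through their paths, because the
  Wasserstein distance of a marginal to itself is 0. The weighted norm then contracts by 1/3, within
  the 1/2 that \<open>weighted_fixed_point\<close> allows.\<close>

lemma solves_along_exists:
  assumes \<mu>: "\<mu> \<in> wspace p (paths T)" and g: "g \<in> paths T"
  shows "\<exists>x. solves_along T b (marginal \<mu>) x0 g x"
proof -
  note \<mu>s = marginal_in_wspace(1)[OF p \<mu>]
  define F where "F x t = x0 + (LINT s:{0..t}|lborel. b s (apply_bcontfun x s) (marginal \<mu> s)) + g t" for x t
  define \<Gamma> :: "(unit \<Rightarrow> (real \<Rightarrow>\<^sub>C 'a)) \<Rightarrow> unit \<Rightarrow> (real \<Rightarrow>\<^sub>C 'a)"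
    where "\<Gamma> X = (\<lambda>_. extend_path T (F (X ())))" for X
  have F_cont: "continuous_on {0..T} (F x)" for x
    unfolding F_def by (intro continuous_intros continuous_on_set_integral drift_set_integrable[OF \<mu>]) auto
  have \<Gamma>_paths: "\<Gamma> X i \<in> paths T" for X i
    unfolding \<Gamma>_def using T by (intro extend_path_in_paths F_cont) auto
  have \<Gamma>_apply: "\<Gamma> X i t = F (X ()) t" if "t \<in> {0..T}" for X i t
    unfolding \<Gamma>_def using T that by (subst extend_path_apply[OF F_cont]) auto
  have "\<exists>X\<in>{X. \<forall>i. X i \<in> paths T}. \<forall>i\<in>UNIV. \<Gamma> X i = X i"
  proof (rule weighted_fixed_point[where T=T and C=C and Z="\<lambda>_. g"])
    show "norm (\<Gamma> (\<lambda>_. g) i t - g t) \<le> norm (\<Gamma> (\<lambda>_. g) () - g)" for i t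
      using norm_bounded[of "\<Gamma> (\<lambda>_. g) () - g" t] by simp
  next
    fix X :: "nat \<Rightarrow> unit \<Rightarrow> (real \<Rightarrow>\<^sub>C 'a)" and L
    assume X: "\<And>n. X n \<in> {X. \<forall>i. X i \<in> paths T}" and L: "uniform_limit UNIV X L sequentially"
    have "L i \<in> paths T" for i
      by (rule closed_sequentially[OF closed_paths _ tendsto_uniform_limitI[OF L]]) (use X in auto)
    then show "L \<in> {X. \<forall>i. X i \<in> paths T}"
      by simp
  next
    fix X Y :: "unit \<Rightarrow> (real \<Rightarrow>\<^sub>C 'a)" and A t and i :: unit
    assume A: "A \<ge> 0" and t: "t \<in> {0..T}"
      and le: "\<And>i t. i \<in> UNIV \<Longrightarrow> t \<in> {0..T} \<Longrightarrow> norm (X i t - Y i t) \<le> A * exp (3 * C * t)"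
    let ?f = "\<lambda>X s. b s (apply_bcontfun (X ()) s) (marginal \<mu> s)"
    have int: "set_integrable lborel {0..t} (?f Z)" for Z
      using t by (intro set_integrable_subset[OF drift_set_integrable[OF \<mu>]]) auto
    have "\<Gamma> X i t - \<Gamma> Y i t = F (X ()) t - F (Y ()) t"
      by (simp only: \<Gamma>_apply[OF t])
    also have "\<dots> = (LINT s:{0..t}|lborel. ?f X s - ?f Y s)"
      by (simp add: F_def set_integral_diff(2)[OF int int])
    also have "norm \<dots> \<le> (LINT s:{0..t}|lborel. norm (?f X s - ?f Y s))"
      using int by (intro set_integral_norm_bound set_integral_diff)
    also have "\<dots> \<le> (LINT s:{0..t}|lborel. C * (A * exp (3 * C * s)))"
    proof (rule set_integral_mono)
      show "set_integrable lborel {0..t} (\<lambda>s. norm (?f X s - ?f Y s))"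
        using int by (intro set_integrable_norm set_integral_diff)
      show "set_integrable lborel {0..t} (\<lambda>s. C * (A * exp (3 * C * s)))"
        by (intro set_integrable_continuous_Icc continuous_intros)
      fix s assume "s \<in> {0..t}"
      then have s: "s \<in> {0..T}"
        using t by auto
      have "norm (?f X s - ?f Y s) \<le> C * (norm (X () s - Y () s) + wasserstein p (marginal \<mu> s) (marginal \<mu> s))"
        by (intro drift_lipschitz s \<mu>s)
      also have "\<dots> \<le> C * (A * exp (3 * C * s))"
        using C_pos le[OF _ s] p by (intro mult_left_mono) (auto simp: wasserstein_self[OF \<mu>s diff_measurable_UNIV])
      finally show "norm (?f X s - ?f Y s) \<le> C * (A * exp (3 * C * s))" .
    qed
    also have "\<dots> \<le> A / 3 * exp (3 * C * t)"
      using C_pos A t by (intro set_integral_exp_le) auto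
    also have "\<dots> \<le> A / 2 * exp (3 * C * t)"
      using A by (intro mult_right_mono) auto
    finally show "norm (\<Gamma> X i t - \<Gamma> Y i t) \<le> A / 2 * exp (3 * C * t)" .
  qed (use T C_pos g \<Gamma>_paths in auto)
  then obtain X where X: "X () \<in> paths T" "\<Gamma> X () = X ()"
    by blast
  then have "solves_along T b (marginal \<mu>) x0 g (X ())"
    using drift_set_integrable[OF \<mu>, of "X ()"] \<Gamma>_apply[of _ X "()"] by (auto simp: solves_along_def F_def)
  then show ?thesis ..
qed

subsection \<open>The solution map and the fixed points of \<open>\<Phi>\<close>\<close>

lemma ex1_solves_along:
  assumes \<mu>: "\<mu> \<in> wspace p (paths T)" and g: "g \<in> paths T"
  shows "\<exists>!x. solves_along T b (marginal \<mu>) x0 g x"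
  using solves_along_exists[OF \<mu> g] solves_along_unique[where m="marginal \<mu>"] marginal_in_wspace(1)[OF p \<mu>]
  by blast

lemma sol_map_solves:
  assumes "\<mu> \<in> wspace p (paths T)" "z \<in> inputs T"
  shows "solves_along T b (marginal \<mu>) (fst z) (snd z) (sol_map T b \<mu> z)"
proof -
  have "\<exists>!x. solves_along T b (marginal \<mu>) (fst z) (snd z) x"
    using assms by (intro ex1_solves_along) auto
  then show ?thesis
    unfolding sol_map_def case_prod_beta' by (rule theI')
qed

lemma sol_map_eqI:
  assumes "\<mu> \<in> wspace p (paths T)" "z \<in> inputs T" "solves_along T b (marginal \<mu>) (fst z) (snd z) x"
  shows "sol_map T b \<mu> z = x"
  using solves_along_unique[OF sol_map_solves[OF assms(1,2)] assms(3) marginal_in_wspace(1)[OF p assms(1)]] .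

lemma sol_map_in_paths:
  assumes "\<mu> \<in> wspace p (paths T)" "z \<in> inputs T"
  shows "sol_map T b \<mu> z \<in> paths T"
  using sol_map_solves[OF assms] by (simp add: solves_along_def)

lemma sol_map_diff_le:
  assumes \<mu>: "\<mu> \<in> wspace p (paths T)" "\<mu>' \<in> wspace p (paths T)" and z: "z \<in> inputs T" "z' \<in> inputs T"
    and A: "A \<ge> 0"
    and W: "\<And>s. s \<in> {0..T} \<Longrightarrow> wasserstein p (marginal \<mu> s) (marginal \<mu>' s) \<le> A * exp (3 * C * s)"
    and t: "t \<in> {0..T}"
  shows "norm (sol_map T b \<mu> z t - sol_map T b \<mu>' z' t) \<le> (3 * norm (z - z') + A / 2) * exp (3 * C * t)"
proof -
  have "norm (sol_map T b \<mu> z t - sol_map T b \<mu>' z' t)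
      \<le> (3 / 2 * (norm (fst z - fst z') + norm (snd z - snd z')) + A / 2) * exp (3 * C * t)"
    by (intro stability[OF sol_map_solves[OF \<mu>(1) z(1)] sol_map_solves[OF \<mu>(2) z(2)] _ _ A W t]
        marginal_in_wspace[OF p \<mu>(1)] marginal_in_wspace[OF p \<mu>(2)])
  \<comment> \<open>The 3 is 3/2 times 2: the sum of the component norms is at most twice the
    product norm.\<close>
  also have "\<dots> \<le> (3 * norm (z - z') + A / 2) * exp (3 * C * t)"
    using norm_add_norm_le_norm_Pair[of "z - z'"] by (intro mult_right_mono) auto
  finally show ?thesis .
qed

lemma norm_sol_map_diff_le:
  assumes \<mu>: "\<mu> \<in> wspace p (paths T)" "\<mu>' \<in> wspace p (paths T)" and z: "z \<in> inputs T" "z' \<in> inputs T"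
    and A: "A \<ge> 0"
    and W: "\<And>s. s \<in> {0..T} \<Longrightarrow> wasserstein p (marginal \<mu> s) (marginal \<mu>' s) \<le> A * exp (3 * C * s)"
  shows "norm (sol_map T b \<mu> z - sol_map T b \<mu>' z') \<le> (3 * norm (z - z') + A / 2) * exp (3 * C * T)"
proof (rule norm_paths_diff_le)
  fix t assume t: "t \<in> {0..T}"
  have "norm (sol_map T b \<mu> z t - sol_map T b \<mu>' z' t) \<le> (3 * norm (z - z') + A / 2) * exp (3 * C * t)"
    by (rule sol_map_diff_le[OF \<mu> z A W t])
  also have "\<dots> \<le> (3 * norm (z - z') + A / 2) * exp (3 * C * T)"
    using C_pos t A by (intro mult_left_mono) auto
  finally show "norm (sol_map T b \<mu> z t - sol_map T b \<mu>' z' t) \<le> (3 * norm (z - z') + A / 2) * exp (3 * C * T)" .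
qed (use T in \<open>auto intro: sol_map_in_paths \<mu> z\<close>)

section \<open>Measurability and moments of the solution map\<close>

lemma wasserstein_marginal_self:
  assumes "\<mu> \<in> wspace p (paths T)"
  shows "wasserstein p (marginal \<mu> s) (marginal \<mu> s) = 0"
  using p by (intro wasserstein_self[OF marginal_in_wspace(1)[OF p assms] diff_measurable_UNIV]) auto

lemma sol_map_Lipschitz:
  assumes \<mu>: "\<mu> \<in> wspace p (paths T)" and z: "z \<in> inputs T" "z' \<in> inputs T"
  shows "norm (sol_map T b \<mu> z - sol_map T b \<mu> z') \<le> 3 * exp (3 * C * T) * norm (z - z')"
  using norm_sol_map_diff_le[OF \<mu> \<mu> z order_refl] by (simp add: wasserstein_marginal_self[OF \<mu>] mult_ac)

lemma sol_map_measurable: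
  assumes \<mu>: "\<mu> \<in> wspace p (paths T)"
  shows "sol_map T b \<mu> \<in> borel_on (inputs T) \<rightarrow>\<^sub>M borel_on (paths T)"
proof -
  have "(3 * exp (3 * C * T))-lipschitz_on (inputs T) (sol_map T b \<mu>)"
    by (rule lipschitz_onI) (use sol_map_Lipschitz[OF \<mu>] in \<open>auto simp: dist_norm\<close>)
  then have "sol_map T b \<mu> \<in> borel_on (inputs T) \<rightarrow>\<^sub>M borel"
    unfolding borel_on_def by (intro borel_measurable_continuous_on_restrict lipschitz_on_continuous_on)
  then show ?thesis
    unfolding borel_on_def[of "paths T"]
    by (intro measurable_restrict_space2) (auto intro: sol_map_in_paths[OF \<mu>])
qed

lemma nn_integral_sol_map_finite:
  assumes \<mu>: "\<mu> \<in> wspace p (paths T)" and \<nu>: "\<nu> \<in> wspace p (inputs T)"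
  shows "(\<integral>\<^sup>+ z. ennreal (norm (sol_map T b \<mu> z) powr p) \<partial>\<nu>) < \<infinity>"
proof (rule nn_integral_affine_powr_finite[OF p])
  show "AE z in \<nu>. norm (sol_map T b \<mu> z) \<le> norm (sol_map T b \<mu> 0) + 3 * exp (3 * C * T) * norm z"
  proof (rule AE_I2)
    fix z assume "z \<in> space \<nu>"
    then have "z \<in> inputs T"
      by (simp add: space_wspace[OF \<nu>])
    moreover have "(0 :: 'a \<times> (real \<Rightarrow>\<^sub>C 'a)) \<in> inputs T"
      by (auto simp: zero_prod_def paths_def)
    ultimately show "norm (sol_map T b \<mu> z) \<le> norm (sol_map T b \<mu> 0) + 3 * exp (3 * C * T) * norm z"
      using sol_map_Lipschitz[OF \<mu>, of z 0] norm_triangle_sub[of "sol_map T b \<mu> z" "sol_map T b \<mu> 0"] by simp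
  qed
qed (use \<nu> wspace_norm_measurable[OF \<nu>] in \<open>auto simp: wspace_def\<close>)

lemma sol_map_measurable_wspace:
  assumes \<mu>: "\<mu> \<in> wspace p (paths T)" and \<nu>: "\<nu> \<in> wspace p (inputs T)"
  shows "sol_map T b \<mu> \<in> \<nu> \<rightarrow>\<^sub>M borel_on (paths T)"
proof -
  have "sets \<nu> = sets (borel_on (inputs T))"
    using \<nu> by (simp add: wspace_def)
  then show ?thesis
    using sol_map_measurable[OF \<mu>] measurable_cong_sets by blast
qed

lemma Phi_in_wspace:
  assumes \<mu>: "\<mu> \<in> wspace p (paths T)" and \<nu>: "\<nu> \<in> wspace p (inputs T)"
  shows "Phi T b \<nu> \<mu> \<in> wspace p (paths T)"
  unfolding Phi_def using \<nu>
  by (intro distr_in_wspace sol_map_measurable_wspace nn_integral_sol_map_finite \<mu>) (auto simp: wspace_def)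

lemma marginal_distr:
  assumes "X \<in> N \<rightarrow>\<^sub>M borel_on (paths T)"
  shows "marginal (distr N (borel_on (paths T)) X) s = distr N borel (\<lambda>z. X z s)"
  using assms by (simp add: marginal_def distr_distr comp_def)

text \<open>The probability space is \<open>\<nu>\<close> itself, with the inputs as sample points,
  and the unknown is a random variable \<open>X\<close> rather than its law. If \<open>X\<close>
  agrees with \<open>sol_map T b (law X)\<close> at every input, pushing \<open>\<nu>\<close>
  forward under both gives the fixed point equation for \<open>law X\<close>.\<close>

lemma fixed_point_exists:
  assumes \<nu>: "\<nu> \<in> wspace p (inputs T)"
  shows "\<exists>\<mu>\<in>wspace p (paths T). Phi T b \<nu> \<mu> = \<mu>"
proof -
  define P :: "('a \<times> (real \<Rightarrow>\<^sub>C 'a) \<Rightarrow> (real \<Rightarrow>\<^sub>C 'a)) set" where "P = {X \<in> \<nu> \<rightarrow>\<^sub>M borel_on (paths T). (\<integral>\<^sup>+ z. ennreal (norm (X z) powr p) \<partial>\<nu>) < \<infinity>}"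
  define law :: "('a \<times> (real \<Rightarrow>\<^sub>C 'a) \<Rightarrow> (real \<Rightarrow>\<^sub>C 'a)) \<Rightarrow> _" where "law X = distr \<nu> (borel_on (paths T)) X" for X
  have prob: "prob_space \<nu>" and space: "space \<nu> = inputs T"
    using \<nu> space_wspace[OF \<nu>] by (auto simp: wspace_def)
  have law: "law X \<in> wspace p (paths T)" if "X \<in> P" for X
    using that prob unfolding law_def P_def by (intro distr_in_wspace) auto
  have P_sol: "sol_map T b (law X) \<in> P" if "X \<in> P" for X
    unfolding P_def using nn_integral_sol_map_finite[OF law[OF that] \<nu>] sol_map_measurable_wspace[OF law[OF that] \<nu>] by simp
  have zero_P: "(\<lambda>_. 0) \<in> P"
    using p unfolding P_def by (auto simp: paths_def)
  have "\<exists>X\<in>P. \<forall>z\<in>inputs T. sol_map T b (law X) z = X z"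
  proof (rule weighted_fixed_point[where T=T and C=C])
    \<comment> \<open>Iteration cannot start at 0, since the first increment would be a solution
      map, in general unbounded in the input. Two solution maps at the same input differ by a
      deterministic amount, hence the start one step later.\<close>
    let ?X = "sol_map T b (law (\<lambda>_. 0))"
    define R where "R = (2 powr (p - 1) * (moment p (law ?X) + moment p (law (\<lambda>_. 0)))) powr (1 / p)"
    show "?X \<in> P"
      by (intro P_sol zero_P)
    fix z :: "'a \<times> (real \<Rightarrow>\<^sub>C 'a)" and t assume z: "z \<in> inputs T" and t: "t \<in> {0..T}"
    have "norm (sol_map T b (law ?X) z - ?X z) \<le> (3 * norm (z - z) + R / 2) * exp (3 * C * T)"
    proof (rule norm_sol_map_diff_le[OF law law z z])
      fix s assume s: "s \<in> {0..T}"
      let ?\<mu> = "law ?X" and ?\<mu>' = "law (\<lambda>_. 0)"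
      have \<mu>: "?\<mu> \<in> wspace p (paths T)" "?\<mu>' \<in> wspace p (paths T)"
        by (intro law P_sol zero_P)+
      let ?W = "wasserstein p (marginal ?\<mu> s) (marginal ?\<mu>' s)"
      have "?W powr p \<le> 2 powr (p - 1) * (moment p (marginal ?\<mu> s) + moment p (marginal ?\<mu>' s))"
        by (intro wasserstein_powr_le_moment[OF p marginal_in_wspace(1)[OF p \<mu>(1)] marginal_in_wspace(1)[OF p \<mu>(2)]])
      also have "\<dots> \<le> 2 powr (p - 1) * (moment p ?\<mu> + moment p ?\<mu>')"
        using marginal_in_wspace(2)[OF p \<mu>(1)] marginal_in_wspace(2)[OF p \<mu>(2)] by (intro mult_left_mono add_mono) auto
      finally have "(?W powr p) powr (1 / p) \<le> R"
        unfolding R_def using p by (intro powr_mono2) auto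
      then have "?W \<le> R * 1"
        using p by (simp add: powr_powr)
      also have "\<dots> \<le> R * exp (3 * C * s)"
        using C_pos s by (intro mult_left_mono) (auto simp: R_def)
      finally show "?W \<le> R * exp (3 * C * s)" .
    qed (auto simp: R_def intro: zero_P P_sol)
    then show "norm (sol_map T b (law ?X) z t - ?X z t) \<le> R / 2 * exp (3 * C * T)"
      using norm_bounded[of "sol_map T b (law ?X) z - ?X z" t] by simp
  next
    fix X :: "nat \<Rightarrow> 'a \<times> (real \<Rightarrow>\<^sub>C 'a) \<Rightarrow> (real \<Rightarrow>\<^sub>C 'a)" and L
    assume X: "\<And>n. X n \<in> P" and L: "uniform_limit (inputs T) X L sequentially"
    have lim: "(\<lambda>n. X n z) \<longlonglongrightarrow> L z" if "z \<in> inputs T" for z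
      using tendsto_uniform_limitI[OF L that] .
    have X_meas: "X n \<in> \<nu> \<rightarrow>\<^sub>M borel" "X n \<in> space \<nu> \<rightarrow> paths T" for n
      using X[of n] by (auto simp: P_def borel_on_def measurable_restrict_space2_iff)
    have L_meas: "L \<in> \<nu> \<rightarrow>\<^sub>M borel"
      by (rule borel_measurable_LIMSEQ_metric[OF X_meas(1)]) (use lim space in auto)
    have "L z \<in> paths T" if "z \<in> space \<nu>" for z
      using closed_sequentially[OF closed_paths _ lim] X_meas(2) that space by (auto simp: Pi_iff)
    then have "L \<in> \<nu> \<rightarrow>\<^sub>M borel_on (paths T)"
      unfolding borel_on_def using L_meas by (intro measurable_restrict_space2) auto
    moreover have "(\<integral>\<^sup>+ z. ennreal (norm (L z) powr p) \<partial>\<nu>) < \<infinity>"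
    proof -
      \<comment> \<open>A single iterate within distance 1 of \<open>L\<close> transfers its finite
        moment to \<open>L\<close>.\<close>
      from uniform_limitD[OF L zero_less_one] obtain n where n: "\<And>z. z \<in> inputs T \<Longrightarrow> dist (X n z) (L z) < 1"
        by (auto simp: eventually_sequentially)
      have "norm (L z) \<le> 1 + 1 * norm (X n z)" if "z \<in> inputs T" for z
        using n[OF that] norm_triangle_sub[of "L z" "X n z"] by (simp add: dist_norm norm_minus_commute)
      then have "AE z in \<nu>. norm (L z) \<le> 1 + 1 * norm (X n z)"
        by (intro AE_I2) (simp add: space)
      from nn_integral_affine_powr_finite[OF p prob _ _ _ _ _ _ this] show ?thesis
        using X[of n] X_meas(1)[of n] by (auto simp: P_def)
    qed
    ultimately show "L \<in> P"
      by (simp add: P_def)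
  next
    fix X Y :: "'a \<times> (real \<Rightarrow>\<^sub>C 'a) \<Rightarrow> (real \<Rightarrow>\<^sub>C 'a)" and A t and z :: "'a \<times> (real \<Rightarrow>\<^sub>C 'a)"
    assume X: "X \<in> P" and Y: "Y \<in> P" and A: "A \<ge> 0" and z: "z \<in> inputs T" and t: "t \<in> {0..T}"
      and le: "\<And>z t. z \<in> inputs T \<Longrightarrow> t \<in> {0..T} \<Longrightarrow> norm (X z t - Y z t) \<le> A * exp (3 * C * t)"
    have [measurable]: "X \<in> \<nu> \<rightarrow>\<^sub>M borel_on (paths T)" "Y \<in> \<nu> \<rightarrow>\<^sub>M borel_on (paths T)"
      using X Y by (auto simp: P_def)
    \<comment> \<open>\<open>X\<close> and \<open>Y\<close> live on the same space, so they couple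
      their laws, and the bound uniform in the input becomes a bound between marginals.\<close>
    have "wasserstein p (marginal (law X) s) (marginal (law Y) s) \<le> A * exp (3 * C * s)" if s: "s \<in> {0..T}" for s
    proof -
      have "wasserstein p (distr \<nu> (borel_on UNIV) (\<lambda>z. X z s)) (distr \<nu> (borel_on UNIV) (\<lambda>z. Y z s)) \<le> A * exp (3 * C * s)"
        using p le[OF _ s] by (intro wasserstein_distr_le prob diff_measurable_UNIV) (auto simp: space)
      then show ?thesis
        by (simp add: law_def marginal_distr)
    qed
    from sol_map_diff_le[OF law[OF X] law[OF Y] z z A this t]
    show "norm (sol_map T b (law X) z t - sol_map T b (law Y) z t) \<le> A / 2 * exp (3 * C * t)"
      by simp
  qed (use T C_pos P_sol in \<open>auto simp: P_def borel_on_def measurable_restrict_space2_iff space\<close>)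
  then obtain X where X: "X \<in> P" "\<And>z. z \<in> inputs T \<Longrightarrow> sol_map T b (law X) z = X z"
    by blast
  then have "Phi T b \<nu> (law X) = law X"
    unfolding Phi_def law_def[of X] by (intro distr_cong) (auto simp: space law_def)
  then show ?thesis
    using law[OF X(1)] by blast
qed

text \<open>Since \<open>(a + A / 2)\<^sup>p \<le> 2\<^sup>p a\<^sup>p / 2 + A\<^sup>p / 2\<close>, the \<open>A\<close>-part keeps a factor
  below \<open>1\<close> and can be absorbed, so that Minkowski's inequality is not needed.\<close>

lemma nn_integral_coupling_powr_le:
  fixes E :: "'b::real_normed_vector set"
  assumes m: "m \<in> couplings \<nu>\<^sub>1 \<nu>\<^sub>2" and \<nu>: "\<nu>\<^sub>1 \<in> wspace p E" "\<nu>\<^sub>2 \<in> wspace p E" and E: "diff_measurable E"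
    and c: "c \<ge> 0" "(\<integral>\<^sup>+ (x, y). ennreal (norm (x - y) powr p) \<partial>m) = ennreal c"
    and "A \<ge> 0" "F \<ge> 0" and nonneg: "\<And>z. U z \<ge> 0"
    and le: "\<And>z. z \<in> space m \<Longrightarrow> U z \<le> (3 * norm (fst z - snd z) + A / 2) * F"
  shows "(\<integral>\<^sup>+ z. ennreal (U z powr p) \<partial>m) \<le> ennreal (F powr p * (6 powr p * c / 2 + A powr p / 2))"
proof -
  interpret prob_space m
    using m by (simp add: couplings_def)
  have [measurable_cong]: "sets m = sets (borel_on E \<Otimes>\<^sub>M borel_on E)"
    using m \<nu> by (simp add: couplings_def wspace_def cong: sets_pair_measure_cong)
  have [measurable]: "(\<lambda>z. norm (fst z - snd z)) \<in> borel_measurable m"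
    using E unfolding diff_measurable_def case_prod_beta' by measurable
  have half: "2 powr (p - 1) = 2 powr p / 2"
    by (simp add: powr_diff)
  have "(2::real) powr p * 3 powr p = 6 powr p"
    by (simp add: powr_mult[symmetric])
  then have six: "2 powr (p - 1) * (3 * d) powr p = 6 powr p / 2 * d powr p" if "d \<ge> 0" for d
    using that by (simp add: half powr_mult)
  have "2 powr (p - 1) * (A / 2) powr p = A powr p / 2"
    using \<open>A \<ge> 0\<close> by (simp add: half powr_divide)
  then have "U z powr p \<le> F powr p * (6 powr p / 2) * norm (fst z - snd z) powr p + F powr p * (A powr p / 2)" if "z \<in> space m" for z
  proof -
    have "U z powr p \<le> ((3 * norm (fst z - snd z) + A / 2) * F) powr p"
      using p nonneg le[OF that] by (intro powr_mono2) auto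
    also have "\<dots> = F powr p * (3 * norm (fst z - snd z) + A / 2) powr p"
      using \<open>A \<ge> 0\<close> \<open>F \<ge> 0\<close> by (simp add: powr_mult)
    also have "\<dots> \<le> F powr p * (2 powr (p - 1) * ((3 * norm (fst z - snd z)) powr p + (A / 2) powr p))"
      using p \<open>A \<ge> 0\<close> by (intro mult_left_mono add_powr_le) auto
    also have "\<dots> = F powr p * (6 powr p / 2 * norm (fst z - snd z) powr p + A powr p / 2)"
      using six[of "norm (fst z - snd z)"] \<open>2 powr (p - 1) * (A / 2) powr p = A powr p / 2\<close>
      by (simp only: distrib_left norm_ge_zero)
    finally show ?thesis
      by (simp add: algebra_simps)
  qed
  then have "(\<integral>\<^sup>+ z. ennreal (U z powr p) \<partial>m) \<le>
      (\<integral>\<^sup>+ z. ennreal (F powr p * (6 powr p / 2)) * ennreal (norm (fst z - snd z) powr p) + ennreal (F powr p * (A powr p / 2)) \<partial>m)"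
    by (intro nn_integral_mono)
      (auto simp: ennreal_mult[symmetric] ennreal_plus[symmetric] simp del: ennreal_plus intro!: ennreal_leI)
  also have "\<dots> = ennreal (F powr p * (6 powr p / 2)) * ennreal c + ennreal (F powr p * (A powr p / 2))"
    using c(2) by (simp add: nn_integral_add nn_integral_cmult emeasure_space_1 case_prod_beta')
  also have "\<dots> = ennreal (F powr p * (6 powr p / 2) * c + F powr p * (A powr p / 2))"
    using c(1) by (simp add: ennreal_mult[symmetric] ennreal_plus[symmetric] del: ennreal_plus)
  finally show ?thesis
    by (simp add: algebra_simps)
qed

text \<open>For the p-th power of the weighted marginal distance, a bound \<open>B\<close> improves
  to \<open>6 powr p * c / 2 + B / 2\<close>. Absorption with \<open>q = 1 / 2\<close> gives
  \<open>6 powr p * c\<close>, which is the first claim. Inserting it as the flow term gives the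
  second claim on path space.\<close>

lemma fixed_points_coupling_bounds:
  assumes \<nu>: "\<nu>\<^sub>1 \<in> wspace p (inputs T)" "\<nu>\<^sub>2 \<in> wspace p (inputs T)"
    and \<mu>: "\<mu>\<^sub>1 \<in> wspace p (paths T)" "\<mu>\<^sub>2 \<in> wspace p (paths T)"
    and fixed: "Phi T b \<nu>\<^sub>1 \<mu>\<^sub>1 = \<mu>\<^sub>1" "Phi T b \<nu>\<^sub>2 \<mu>\<^sub>2 = \<mu>\<^sub>2"
    and m: "m \<in> couplings \<nu>\<^sub>1 \<nu>\<^sub>2"
    and c: "c \<ge> 0" "(\<integral>\<^sup>+ (x, y). ennreal (norm (x - y) powr p) \<partial>m) = ennreal c"
  shows "s \<in> {0..T} \<Longrightarrow> wasserstein p (marginal \<mu>\<^sub>1 s) (marginal \<mu>\<^sub>2 s) \<le> 6 * c powr (1 / p) * exp (3 * C * s)"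
    and "wasserstein p \<mu>\<^sub>1 \<mu>\<^sub>2 powr p \<le> (6 * exp (3 * C * T)) powr p * c"
proof -
  have prob: "prob_space m" and sets_m: "sets m = sets (\<nu>\<^sub>1 \<Otimes>\<^sub>M \<nu>\<^sub>2)"
    and distr_m: "distr m \<nu>\<^sub>1 fst = \<nu>\<^sub>1" "distr m \<nu>\<^sub>2 snd = \<nu>\<^sub>2"
    using m by (auto simp: couplings_def)
  have [measurable]: "fst \<in> m \<rightarrow>\<^sub>M \<nu>\<^sub>1" "snd \<in> m \<rightarrow>\<^sub>M \<nu>\<^sub>2"
    using sets_m by (auto cong: measurable_cong_sets)
  have space_m: "fst z \<in> inputs T" "snd z \<in> inputs T" if "z \<in> space m" for z
  proof -
    have "space m = inputs T \<times> inputs T"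
      by (simp add: sets_eq_imp_space_eq[OF sets_m] space_pair_measure space_wspace[OF \<nu>(1)] space_wspace[OF \<nu>(2)])
    then show "fst z \<in> inputs T" "snd z \<in> inputs T"
      using that by (simp_all add: mem_Times_iff)
  qed
  \<comment> \<open>Two solutions driven by a coupled pair of inputs; because the measures are fixed
    points, the laws of \<open>X\<close> and \<open>Y\<close> are exactly
    \<open>\<mu>\<^sub>1\<close> and \<open>\<mu>\<^sub>2\<close>.\<close>
  define X where "X z = sol_map T b \<mu>\<^sub>1 (fst z)" for z :: "('a \<times> (real \<Rightarrow>\<^sub>C 'a)) \<times> ('a \<times> (real \<Rightarrow>\<^sub>C 'a))"
  define Y where "Y z = sol_map T b \<mu>\<^sub>2 (snd z)" for z :: "('a \<times> (real \<Rightarrow>\<^sub>C 'a)) \<times> ('a \<times> (real \<Rightarrow>\<^sub>C 'a))"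
  note [measurable] = sol_map_measurable_wspace[OF \<mu>(1) \<nu>(1)] sol_map_measurable_wspace[OF \<mu>(2) \<nu>(2)]
  have X [measurable]: "X \<in> m \<rightarrow>\<^sub>M borel_on (paths T)" and Y [measurable]: "Y \<in> m \<rightarrow>\<^sub>M borel_on (paths T)"
    unfolding X_def Y_def by measurable
  have "distr m (borel_on (paths T)) X = distr (distr m \<nu>\<^sub>1 fst) (borel_on (paths T)) (sol_map T b \<mu>\<^sub>1)"
    "distr m (borel_on (paths T)) Y = distr (distr m \<nu>\<^sub>2 snd) (borel_on (paths T)) (sol_map T b \<mu>\<^sub>2)"
    by (simp_all add: distr_distr comp_def X_def[abs_def] Y_def[abs_def])
  then have \<mu>_eq: "\<mu>\<^sub>1 = distr m (borel_on (paths T)) X" "\<mu>\<^sub>2 = distr m (borel_on (paths T)) Y"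
    using fixed by (simp_all add: distr_m Phi_def)
  note integral_le = nn_integral_coupling_powr_le[OF m \<nu> diff_measurable_inputs c]
  let ?W = "\<lambda>s. wasserstein p (marginal \<mu>\<^sub>1 s) (marginal \<mu>\<^sub>2 s)"
  have W_le: "?W s powr p \<le> exp (3 * C * s) powr p * (6 powr p * c / 2 + A powr p / 2)"
    if A: "A \<ge> 0" "\<And>s. s \<in> {0..T} \<Longrightarrow> ?W s \<le> A * exp (3 * C * s)" and s: "s \<in> {0..T}" for A s
  proof -
    have "wasserstein p (distr m (borel_on UNIV) (\<lambda>z. X z s)) (distr m (borel_on UNIV) (\<lambda>z. Y z s)) powr p
        \<le> exp (3 * C * s) powr p * (6 powr p * c / 2 + A powr p / 2)"
    proof (rule wasserstein_distr_powr_le[OF diff_measurable_UNIV prob])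
      show "(\<integral>\<^sup>+ z. ennreal (norm (X z s - Y z s) powr p) \<partial>m) \<le> ennreal (exp (3 * C * s) powr p * (6 powr p * c / 2 + A powr p / 2))"
        by (rule integral_le[OF A(1)]) (auto simp: X_def Y_def intro!: sol_map_diff_le \<mu> space_m A s)
    qed (use p c in auto)
    then show ?thesis
      unfolding \<mu>_eq marginal_distr[OF X] marginal_distr[OF Y] by simp
  qed
  have W_eq: "?W s = (?W s * exp (- 3 * C * s)) * exp (3 * C * s)" for s
    by (simp add: mult.assoc exp_add[symmetric])
  define h where "h s = (?W s * exp (- 3 * C * s)) powr p" for s
  have W_h: "?W s = h s powr (1 / p) * exp (3 * C * s)" for s
    using p W_eq[of s] by (simp add: h_def powr_powr)
  have h_le: "h s \<le> 6 powr p * c / 2 / (1 - 1 / 2)" if s: "s \<in> {0..T}" for s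
  proof (rule self_bound[where I="{0..T}" and h=h and B="2 powr (p - 1) * (moment p \<mu>\<^sub>1 + moment p \<mu>\<^sub>2)", OF _ _ _ _ s])
    fix s assume s: "s \<in> {0..T}"
    \<comment> \<open>The a priori bound for the absorption: marginal moments are bounded by the
      path-space moments, and the weight in \<open>h\<close> is at most 1.\<close>
    have "h s \<le> ?W s powr p"
      unfolding h_def using p C_pos s by (intro powr_mono2 mult_left_le) auto
    also have "\<dots> \<le> 2 powr (p - 1) * (moment p (marginal \<mu>\<^sub>1 s) + moment p (marginal \<mu>\<^sub>2 s))"
      by (intro wasserstein_powr_le_moment[OF p marginal_in_wspace(1)[OF p \<mu>(1)] marginal_in_wspace(1)[OF p \<mu>(2)]])
    also have "\<dots> \<le> 2 powr (p - 1) * (moment p \<mu>\<^sub>1 + moment p \<mu>\<^sub>2)"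
      using marginal_in_wspace(2)[OF p \<mu>(1)] marginal_in_wspace(2)[OF p \<mu>(2)] by (intro mult_left_mono add_mono) auto
    finally show "h s \<le> 2 powr (p - 1) * (moment p \<mu>\<^sub>1 + moment p \<mu>\<^sub>2)" .
  next
    fix B s assume B: "B \<ge> 0" "\<And>r. r \<in> {0..T} \<Longrightarrow> h r \<le> B" and s: "s \<in> {0..T}"
    have "?W r \<le> B powr (1 / p) * exp (3 * C * r)" if "r \<in> {0..T}" for r
      unfolding W_h[of r] using p B(2)[OF that] by (intro mult_right_mono powr_mono2) (auto simp: h_def)
    then have "?W s powr p \<le> exp (3 * C * s) powr p * (6 powr p * c / 2 + (B powr (1 / p)) powr p / 2)"
      by (intro W_le s) auto
    moreover have "?W s powr p = h s * exp (3 * C * s) powr p"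
    proof -
      have "?W s powr p = ((?W s * exp (- 3 * C * s)) * exp (3 * C * s)) powr p"
        using W_eq[of s] by presburger
      then show ?thesis
        by (simp add: h_def powr_mult)
    qed
    ultimately have "h s * exp (3 * C * s) powr p \<le> (6 powr p * c / 2 + B / 2) * exp (3 * C * s) powr p"
      using p B(1) by (simp add: powr_powr mult.commute)
    then show "h s \<le> 6 powr p * c / 2 + 1 / 2 * B"
      by simp
  qed (auto simp: h_def)
  have c_powr: "(6 * c powr (1 / p)) powr p = 6 powr p * c"
    using p c(1) by (simp add: powr_mult powr_powr)
  show *: "?W s \<le> 6 * c powr (1 / p) * exp (3 * C * s)" if "s \<in> {0..T}" for s
  proof -
    have "h s powr (1 / p) \<le> ((6 * c powr (1 / p)) powr p) powr (1 / p)"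
      unfolding c_powr using p h_le[OF that] by (intro powr_mono2) (auto simp: h_def)
    then show ?thesis
      unfolding W_h[of s] using p by (intro mult_right_mono) (auto simp: powr_powr)
  qed
  \<comment> \<open>The flow term is now \<open>A = 6 * c powr (1 / p)\<close>, for which both
    halves on the right equal \<open>6 powr p * c / 2\<close>.\<close>
  have "wasserstein p (distr m (borel_on (paths T)) X) (distr m (borel_on (paths T)) Y) powr p
      \<le> exp (3 * C * T) powr p * (6 powr p * c / 2 + (6 * c powr (1 / p)) powr p / 2)"
  proof (rule wasserstein_distr_powr_le[OF diff_measurable_bcontfun prob X Y])
    show "(\<integral>\<^sup>+ z. ennreal (norm (X z - Y z) powr p) \<partial>m) \<le> ennreal (exp (3 * C * T) powr p * (6 powr p * c / 2 + (6 * c powr (1 / p)) powr p / 2))"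
    proof (rule integral_le)
      show "norm (X z - Y z) \<le> (3 * norm (fst z - snd z) + 6 * c powr (1 / p) / 2) * exp (3 * C * T)" if "z \<in> space m" for z
        unfolding X_def Y_def by (rule norm_sol_map_diff_le[OF \<mu> space_m[OF that] _ *]) simp_all
    qed simp_all
  qed (use p c in auto)
  then show "wasserstein p \<mu>\<^sub>1 \<mu>\<^sub>2 powr p \<le> (6 * exp (3 * C * T)) powr p * c"
    unfolding c_powr \<mu>_eq[symmetric] by (simp add: powr_mult mult_ac)
qed

text \<open>The constant of the coupling bound does not depend on the coupling, so after division by
  \<open>L\<close> it passes to the infimum over couplings.\<close>

lemma fixed_points_Lipschitz:
  assumes \<nu>: "\<nu>\<^sub>1 \<in> wspace p (inputs T)" "\<nu>\<^sub>2 \<in> wspace p (inputs T)"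
    and \<mu>: "\<mu>\<^sub>1 \<in> wspace p (paths T)" "\<mu>\<^sub>2 \<in> wspace p (paths T)"
    and fixed: "Phi T b \<nu>\<^sub>1 \<mu>\<^sub>1 = \<mu>\<^sub>1" "Phi T b \<nu>\<^sub>2 \<mu>\<^sub>2 = \<mu>\<^sub>2"
  shows "wasserstein p \<mu>\<^sub>1 \<mu>\<^sub>2 \<le> 6 * exp (3 * C * T) * wasserstein p \<nu>\<^sub>1 \<nu>\<^sub>2"
proof -
  define L where "L = 6 * exp (3 * C * T)"
  have "L > 0"
    by (simp add: L_def)
  have "wasserstein p \<mu>\<^sub>1 \<mu>\<^sub>2 / L \<le> wasserstein p \<nu>\<^sub>1 \<nu>\<^sub>2"
  proof (rule le_wassersteinI[OF p \<nu>])
    fix m c assume "m \<in> couplings \<nu>\<^sub>1 \<nu>\<^sub>2" "c \<ge> 0" "(\<integral>\<^sup>+ (x, y). ennreal (norm (x - y) powr p) \<partial>m) = ennreal c"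
    from fixed_points_coupling_bounds(2)[OF assms this]
    have "wasserstein p \<mu>\<^sub>1 \<mu>\<^sub>2 powr p \<le> L powr p * c"
      by (simp add: L_def)
    then show "(wasserstein p \<mu>\<^sub>1 \<mu>\<^sub>2 / L) powr p \<le> c"
      using \<open>L > 0\<close> by (simp add: powr_divide field_simps)
  qed (use \<open>L > 0\<close> in simp)
  then show ?thesis
    using \<open>L > 0\<close> by (simp add: L_def field_simps)
qed

text \<open>The diagonal coupling has cost 0, so the marginals of the two fixed points are at
  distance 0. Then the two solution maps agree at every input, and the measures agree as
  push-forwards of \<open>\<nu>\<close>. This yields equality of measures without deducing it from a
  vanishing distance on path space.\<close>

lemma fixed_point_unique:
  assumes \<nu>: "\<nu> \<in> wspace p (inputs T)" and \<mu>: "\<mu>\<^sub>1 \<in> wspace p (paths T)" "\<mu>\<^sub>2 \<in> wspace p (paths T)"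
    and fixed: "Phi T b \<nu> \<mu>\<^sub>1 = \<mu>\<^sub>1" "Phi T b \<nu> \<mu>\<^sub>2 = \<mu>\<^sub>2"
  shows "\<mu>\<^sub>1 = \<mu>\<^sub>2"
proof -
  interpret prob_space \<nu>
    using \<nu> by (simp add: wspace_def)
  have space: "space \<nu> = inputs T"
    by (rule space_wspace[OF \<nu>])
  let ?m = "distr \<nu> (\<nu> \<Otimes>\<^sub>M \<nu>) (\<lambda>z. (z, z))"
  have m: "?m \<in> couplings \<nu> \<nu>"
    using coupling_distr_Pair[OF prob_space_axioms measurable_ident measurable_ident] by (simp add: id_def distr_id)
  have [measurable_cong]: "sets \<nu> = sets (borel_on (inputs T))"
    using \<nu> by (simp add: wspace_def)
  have [measurable]: "(\<lambda>z. norm (fst z - snd z)) \<in> borel_measurable (\<nu> \<Otimes>\<^sub>M \<nu>)"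
    using diff_measurable_inputs[of T, where 'a='a] unfolding diff_measurable_def case_prod_beta' by measurable
  have "(\<integral>\<^sup>+ (x, y). ennreal (norm (x - y) powr p) \<partial>?m) = ennreal 0"
    using p by (simp add: case_prod_beta' nn_integral_distr)
  note bound = fixed_points_coupling_bounds(1)[OF \<nu> \<nu> \<mu> fixed m order_refl this]
  have "norm (sol_map T b \<mu>\<^sub>1 z - sol_map T b \<mu>\<^sub>2 z) \<le> (3 * norm (z - z) + 0 / 2) * exp (3 * C * T)" if "z \<in> inputs T" for z
    using bound by (intro norm_sol_map_diff_le \<mu> that) auto
  then have "sol_map T b \<mu>\<^sub>1 z = sol_map T b \<mu>\<^sub>2 z" if "z \<in> inputs T" for z
    using that by fastforce
  then have "Phi T b \<nu> \<mu>\<^sub>1 = Phi T b \<nu> \<mu>\<^sub>2"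
    unfolding Phi_def by (intro distr_cong) (auto simp: space)
  then show ?thesis
    using fixed by simp
qed

lemma ex1_fixed_point:
  assumes "\<nu> \<in> wspace p (inputs T)"
  shows "\<exists>!\<mu>. \<mu> \<in> wspace p (paths T) \<and> Phi T b \<nu> \<mu> = \<mu>"
  using fixed_point_exists[OF assms] fixed_point_unique[OF assms] by blast

lemma Psi_fixed_point:
  assumes "\<nu> \<in> wspace p (inputs T)"
  shows "Psi T p b \<nu> \<in> wspace p (paths T)" "Phi T b \<nu> (Psi T p b \<nu>) = Psi T p b \<nu>"
  unfolding Psi_def using theI'[OF ex1_fixed_point[OF assms]] by auto

lemma Psi_eqI:
  assumes "\<nu> \<in> wspace p (inputs T)" "\<mu> \<in> wspace p (paths T)" "Phi T b \<nu> \<mu> = \<mu>"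
  shows "Psi T p b \<nu> = \<mu>"
  using fixed_point_unique[OF assms(1) Psi_fixed_point(1)[OF assms(1)] assms(2) Psi_fixed_point(2)[OF assms(1)] assms(3)] .

section \<open>Solutions of the McKean-Vlasov equation and their laws\<close>

lemma mkv_solution_sol_map_Psi:
  assumes L: "Lp_input T p M \<zeta> W"
  shows "mkv_solution T p b M \<zeta> W (\<lambda>\<omega>. sol_map T b (Psi T p b (input_law T M \<zeta> W)) (\<zeta> \<omega>, W \<omega>))"
proof -
  define \<mu> where "\<mu> = Psi T p b (input_law T M \<zeta> W)"
  define X where "X \<omega> = sol_map T b \<mu> (\<zeta> \<omega>, W \<omega>)" for \<omega>
  have Z [measurable]: "(\<lambda>\<omega>. (\<zeta> \<omega>, W \<omega>)) \<in> M \<rightarrow>\<^sub>M borel_on (inputs T)"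
    using L by (simp add: Lp_input_def)
  have \<mu>: "\<mu> \<in> wspace p (paths T)" "Phi T b (input_law T M \<zeta> W) \<mu> = \<mu>"
    unfolding \<mu>_def by (intro Psi_fixed_point input_law_in_wspace[OF p L])+
  note [measurable] = sol_map_measurable[OF \<mu>(1)]
  have X [measurable]: "X \<in> M \<rightarrow>\<^sub>M borel_on (paths T)"
    unfolding X_def by measurable
  have "\<mu> = distr M (borel_on (paths T)) X"
    unfolding X_def by (subst \<mu>(2)[symmetric]) (simp add: Phi_def input_law_def distr_distr comp_def)
  then have marg: "distr M borel (\<lambda>\<omega>. X \<omega> s) = marginal \<mu> s" for s
    using marginal_distr[OF X] by simp
  have "solves_along T b (marginal \<mu>) (\<zeta> \<omega>) (W \<omega>) (X \<omega>)" if "\<omega> \<in> space M" for \<omega>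
    using sol_map_solves[OF \<mu>(1) measurable_space[OF Z that, unfolded space_borel_on]] by (simp add: X_def)
  then have "mkv_solution T p b M \<zeta> W X"
    unfolding mkv_solution_def marg using marginal_in_wspace(1)[OF p \<mu>(1)] by auto
  then show ?thesis
    unfolding X_def \<mu>_def .
qed

text \<open>A solution solves the equation frozen along its own marginals, so almost surely it is
  the solution map of its own law. Its law is therefore fixed by \<open>Phi\<close>, and uniqueness
  of the fixed point determines first the law and then, almost surely, the solution.\<close>

lemma mkv_solution_eq_sol_map:
  assumes L: "Lp_input T p M \<zeta> W" and Y: "mkv_solution T p b M \<zeta> W Y"
  shows "path_law T M Y = Psi T p b (input_law T M \<zeta> W)"
    and "AE \<omega> in M. Y \<omega> = sol_map T b (Psi T p b (input_law T M \<zeta> W)) (\<zeta> \<omega>, W \<omega>)"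
proof -
  interpret prob_space M
    using L by (simp add: Lp_input_def)
  define Z where "Z \<omega> = (\<zeta> \<omega>, W \<omega>)" for \<omega>
  have Z [measurable]: "Z \<in> M \<rightarrow>\<^sub>M borel_on (inputs T)"
    using L by (simp add: Lp_input_def Z_def[abs_def])
  have Y_meas [measurable]: "Y \<in> M \<rightarrow>\<^sub>M borel_on (paths T)"
    using Y by (simp add: mkv_solution_def)
  define \<nu> where "\<nu> = input_law T M \<zeta> W"
  have \<nu>: "\<nu> \<in> wspace p (inputs T)" "\<nu> = distr M (borel_on (inputs T)) Z"
    using input_law_in_wspace[OF p L] by (simp_all add: \<nu>_def input_law_def Z_def[abs_def])
  define \<mu> where "\<mu> = path_law T M Y"
  have marg: "marginal \<mu> = (\<lambda>s. distr M borel (\<lambda>\<omega>. Y \<omega> s))"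
    unfolding \<mu>_def path_law_def by (intro ext marginal_distr) simp
  have marg_wspace: "marginal \<mu> s \<in> wspace p UNIV" if "s \<in> {0..T}" for s
    using Y that by (simp add: marg mkv_solution_def)
  have solves: "AE \<omega> in M. solves_along T b (marginal \<mu>) (fst (Z \<omega>)) (snd (Z \<omega>)) (Y \<omega>)"
    using Y by (simp add: marg mkv_solution_def Z_def)
  \<comment> \<open>The finite \<open>p\<close>-th moment of \<open>Y\<close> in supremum norm is not part of being a solution; it comes from
    comparing almost every path of \<open>Y\<close> with a single one, along the same flow of marginals.\<close>
  obtain \<omega>\<^sub>0 where \<omega>\<^sub>0: "solves_along T b (marginal \<mu>) (fst (Z \<omega>\<^sub>0)) (snd (Z \<omega>\<^sub>0)) (Y \<omega>\<^sub>0)"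
    using eventually_happens[OF solves] by (auto simp: AE_False trivial_limit_def)
  have "(\<integral>\<^sup>+ \<omega>. ennreal (norm (Y \<omega>) powr p) \<partial>M) < \<infinity>"
  proof (rule nn_integral_affine_powr_finite[OF p prob_space_axioms])
    show "AE \<omega> in M. norm (Y \<omega>) \<le> norm (Y \<omega>\<^sub>0) + 3 * exp (3 * C * T) * norm (Z \<omega>\<^sub>0) + 3 * exp (3 * C * T) * norm (Z \<omega>)"
      using solves
    proof eventually_elim
      case (elim \<omega>)
      have "norm (Y \<omega> - Y \<omega>\<^sub>0) \<le> 3 / 2 * (norm (fst (Z \<omega> - Z \<omega>\<^sub>0)) + norm (snd (Z \<omega> - Z \<omega>\<^sub>0))) * exp (3 * C * T)"
        using stability_same_flow[OF elim \<omega>\<^sub>0 marg_wspace] by simp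
      also have "\<dots> \<le> 3 / 2 * (2 * (norm (Z \<omega>) + norm (Z \<omega>\<^sub>0))) * exp (3 * C * T)"
        using norm_add_norm_le_norm_Pair[of "Z \<omega> - Z \<omega>\<^sub>0"] norm_triangle_ineq4[of "Z \<omega>" "Z \<omega>\<^sub>0"]
        by (intro mult_right_mono mult_left_mono) auto
      finally show ?case
        using norm_triangle_sub[of "Y \<omega>" "Y \<omega>\<^sub>0"] by (simp add: algebra_simps)
    qed
    have "(\<integral>\<^sup>+ z. ennreal (norm z powr p) \<partial>\<nu>) < \<infinity>"
      using \<nu>(1) by (simp add: wspace_def)
    moreover note [measurable] = norm_measurable_borel_on[of "inputs T :: ('a \<times> (real \<Rightarrow>\<^sub>C 'a)) set"]
    ultimately show "(\<integral>\<^sup>+ \<omega>. ennreal (norm (Z \<omega>) powr p) \<partial>M) < \<infinity>"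
      by (simp add: \<nu>(2) nn_integral_distr)
    show "(\<lambda>\<omega>. norm (Z \<omega>)) \<in> borel_measurable M"
      by measurable
  qed auto
  then have \<mu>: "\<mu> \<in> wspace p (paths T)"
    unfolding \<mu>_def path_law_def by (intro distr_in_wspace prob_space_axioms) auto
  have Z_inputs: "Z \<omega> \<in> inputs T" if "\<omega> \<in> space M" for \<omega>
    using measurable_space[OF Z that] by simp
  have Y_eq: "AE \<omega> in M. Y \<omega> = sol_map T b \<mu> (Z \<omega>)"
    using solves AE_space
    by eventually_elim (use sol_map_eqI[OF \<mu>] Z_inputs in \<open>auto simp del: mem_Times_iff\<close>)
  note [measurable] = sol_map_measurable[OF \<mu>]
  have "\<mu> = distr M (borel_on (paths T)) Y"
    by (simp add: \<mu>_def path_law_def)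
  also have "\<dots> = distr M (borel_on (paths T)) (\<lambda>\<omega>. sol_map T b \<mu> (Z \<omega>))"
    by (rule distr_cong_AE[OF refl refl Y_eq]) measurable
  also have "\<dots> = Phi T b \<nu> \<mu>"
    by (simp add: Phi_def \<nu>(2) distr_distr comp_def)
  finally have "Psi T p b \<nu> = \<mu>"
    by (intro Psi_eqI[OF \<nu>(1) \<mu>]) simp
  then show "path_law T M Y = Psi T p b (input_law T M \<zeta> W)"
    "AE \<omega> in M. Y \<omega> = sol_map T b (Psi T p b (input_law T M \<zeta> W)) (\<zeta> \<omega>, W \<omega>)"
    using Y_eq by (simp_all add: \<mu>_def \<nu>_def Z_def)
qed

end

theorem theorem7:
  fixes T p K :: real and b :: "'a::euclidean_space drift"
  assumes T: "T > 0" and p: "p \<ge> 1"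
    and meas: "(\<lambda>(t, x, \<mu>). b t x \<mu>) \<in> borel_on {0..T} \<Otimes>\<^sub>M (borel \<Otimes>\<^sub>M wborel p UNIV) \<rightarrow>\<^sub>M borel"
    and lip: "\<And>t x x' \<mu> \<mu>'. t \<in> {0..T} \<Longrightarrow> \<mu> \<in> wspace p UNIV \<Longrightarrow> \<mu>' \<in> wspace p UNIV \<Longrightarrow>
        norm (b t x \<mu> - b t x' \<mu>') powr p
          \<le> K * (norm (x - x') powr p + wasserstein p \<mu> \<mu>' powr p)"
    and int0: "set_integrable lborel {0..T} (\<lambda>t. b t 0 (return borel 0))"
  shows
    \<comment> \<open>the solution map is well defined\<close>
    "(\<forall>\<mu>\<in>wspace p (paths T).
        (\<forall>x0. \<forall>g\<in>paths T. \<exists>!x. solves_along T b (marginal \<mu>) x0 g x) \<and>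
        sol_map T b \<mu> \<in> borel_on (inputs T) \<rightarrow>\<^sub>M borel_on (paths T)) \<and>
    \<comment> \<open>(i)\<close>
    (\<forall>(M :: 'w measure) \<zeta> W. Lp_input T p M \<zeta> W \<longrightarrow>
        Phi T b (input_law T M \<zeta> W) \<in> wspace p (paths T) \<rightarrow> wspace p (paths T) \<and>
        (\<exists>!\<mu>. \<mu> \<in> wspace p (paths T) \<and> Phi T b (input_law T M \<zeta> W) \<mu> = \<mu>)) \<and>
    \<comment> \<open>(ii)\<close>
    (\<forall>\<nu>\<in>wspace p (inputs T).
        \<exists>!\<mu>. \<mu> \<in> wspace p (paths T) \<and> Phi T b \<nu> \<mu> = \<mu>) \<and>
    (\<exists>L\<ge>0. \<forall>\<nu>\<^sub>1\<in>wspace p (inputs T). \<forall>\<nu>\<^sub>2\<in>wspace p (inputs T).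
        wasserstein p (Psi T p b \<nu>\<^sub>1) (Psi T p b \<nu>\<^sub>2) \<le> L * wasserstein p \<nu>\<^sub>1 \<nu>\<^sub>2) \<and>
    \<comment> \<open>(iii)\<close>
    (\<forall>(M :: 'w measure) \<zeta> W. Lp_input T p M \<zeta> W \<longrightarrow>
        (let X = (\<lambda>\<omega>. sol_map T b (Psi T p b (input_law T M \<zeta> W)) (\<zeta> \<omega>, W \<omega>)) in
          mkv_solution T p b M \<zeta> W X \<and>
          (\<forall>Y. mkv_solution T p b M \<zeta> W Y \<longrightarrow> (AE \<omega> in M. Y \<omega> = X \<omega>)))) \<and>
    \<comment> \<open>(iv)\<close>
    (\<exists>C>0. \<forall>(M\<^sub>1 :: 'u measure) \<zeta>\<^sub>1 W\<^sub>1 X\<^sub>1 (M\<^sub>2 :: 'v measure) \<zeta>\<^sub>2 W\<^sub>2 X\<^sub>2.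
        Lp_input T p M\<^sub>1 \<zeta>\<^sub>1 W\<^sub>1 \<longrightarrow> Lp_input T p M\<^sub>2 \<zeta>\<^sub>2 W\<^sub>2 \<longrightarrow>
        mkv_solution T p b M\<^sub>1 \<zeta>\<^sub>1 W\<^sub>1 X\<^sub>1 \<longrightarrow> mkv_solution T p b M\<^sub>2 \<zeta>\<^sub>2 W\<^sub>2 X\<^sub>2 \<longrightarrow>
        wasserstein p (path_law T M\<^sub>1 X\<^sub>1) (path_law T M\<^sub>2 X\<^sub>2)
          \<le> C * wasserstein p (input_law T M\<^sub>1 \<zeta>\<^sub>1 W\<^sub>1) (input_law T M\<^sub>2 \<zeta>\<^sub>2 W\<^sub>2)) \<and>
    (\<forall>(M\<^sub>1 :: 'u measure) \<zeta>\<^sub>1 W\<^sub>1 X\<^sub>1 (M\<^sub>2 :: 'v measure) \<zeta>\<^sub>2 W\<^sub>2 X\<^sub>2.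
        Lp_input T p M\<^sub>1 \<zeta>\<^sub>1 W\<^sub>1 \<longrightarrow> Lp_input T p M\<^sub>2 \<zeta>\<^sub>2 W\<^sub>2 \<longrightarrow>
        mkv_solution T p b M\<^sub>1 \<zeta>\<^sub>1 W\<^sub>1 X\<^sub>1 \<longrightarrow> mkv_solution T p b M\<^sub>2 \<zeta>\<^sub>2 W\<^sub>2 X\<^sub>2 \<longrightarrow>
        input_law T M\<^sub>1 \<zeta>\<^sub>1 W\<^sub>1 = input_law T M\<^sub>2 \<zeta>\<^sub>2 W\<^sub>2 \<longrightarrow>
        path_law T M\<^sub>1 X\<^sub>1 = path_law T M\<^sub>2 X\<^sub>2)"
proof (intro conjI)
  interpret mkv_drift T p K b
    using T p meas lip int0 by unfold_locales
  show "\<forall>\<mu>\<in>wspace p (paths T).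
      (\<forall>x0. \<forall>g\<in>paths T. \<exists>!x. solves_along T b (marginal \<mu>) x0 g x) \<and>
      sol_map T b \<mu> \<in> borel_on (inputs T) \<rightarrow>\<^sub>M borel_on (paths T)"
    using ex1_solves_along sol_map_measurable by blast
  show "\<forall>(M :: 'w measure) \<zeta> W. Lp_input T p M \<zeta> W \<longrightarrow>
      Phi T b (input_law T M \<zeta> W) \<in> wspace p (paths T) \<rightarrow> wspace p (paths T) \<and>
      (\<exists>!\<mu>. \<mu> \<in> wspace p (paths T) \<and> Phi T b (input_law T M \<zeta> W) \<mu> = \<mu>)"
    by (intro allI impI conjI Pi_I Phi_in_wspace ex1_fixed_point input_law_in_wspace[OF p])
  show "\<forall>\<nu>\<in>wspace p (inputs T). \<exists>!\<mu>. \<mu> \<in> wspace p (paths T) \<and> Phi T b \<nu> \<mu> = \<mu>"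
    by (intro ballI ex1_fixed_point)
  have Psi_Lipschitz: "wasserstein p (Psi T p b \<nu>\<^sub>1) (Psi T p b \<nu>\<^sub>2) \<le> 6 * exp (3 * C * T) * wasserstein p \<nu>\<^sub>1 \<nu>\<^sub>2"
    if "\<nu>\<^sub>1 \<in> wspace p (inputs T)" "\<nu>\<^sub>2 \<in> wspace p (inputs T)" for \<nu>\<^sub>1 \<nu>\<^sub>2
    by (intro fixed_points_Lipschitz Psi_fixed_point that)
  \<comment> \<open>The same constant serves for \<open>Psi\<close> and for the laws of solutions,
    which are values of \<open>Psi\<close>; it depends only on \<open>T\<close>, \<open>p\<close>
    and \<open>K\<close>.\<close>
  have const_pos: "6 * exp (3 * C * T) > 0"
    by simp
  show "\<exists>L\<ge>0. \<forall>\<nu>\<^sub>1\<in>wspace p (inputs T). \<forall>\<nu>\<^sub>2\<in>wspace p (inputs T).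
      wasserstein p (Psi T p b \<nu>\<^sub>1) (Psi T p b \<nu>\<^sub>2) \<le> L * wasserstein p \<nu>\<^sub>1 \<nu>\<^sub>2"
    using Psi_Lipschitz less_imp_le[OF const_pos] by blast
  show "\<forall>(M :: 'w measure) \<zeta> W. Lp_input T p M \<zeta> W \<longrightarrow>
      (let X = (\<lambda>\<omega>. sol_map T b (Psi T p b (input_law T M \<zeta> W)) (\<zeta> \<omega>, W \<omega>)) in
        mkv_solution T p b M \<zeta> W X \<and>
        (\<forall>Y. mkv_solution T p b M \<zeta> W Y \<longrightarrow> (AE \<omega> in M. Y \<omega> = X \<omega>)))"
    unfolding Let_def using mkv_solution_sol_map_Psi mkv_solution_eq_sol_map(2) by blast
  show "\<exists>C>0. \<forall>(M\<^sub>1 :: 'u measure) \<zeta>\<^sub>1 W\<^sub>1 X\<^sub>1 (M\<^sub>2 :: 'v measure) \<zeta>\<^sub>2 W\<^sub>2 X\<^sub>2.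
      Lp_input T p M\<^sub>1 \<zeta>\<^sub>1 W\<^sub>1 \<longrightarrow> Lp_input T p M\<^sub>2 \<zeta>\<^sub>2 W\<^sub>2 \<longrightarrow>
      mkv_solution T p b M\<^sub>1 \<zeta>\<^sub>1 W\<^sub>1 X\<^sub>1 \<longrightarrow> mkv_solution T p b M\<^sub>2 \<zeta>\<^sub>2 W\<^sub>2 X\<^sub>2 \<longrightarrow>
      wasserstein p (path_law T M\<^sub>1 X\<^sub>1) (path_law T M\<^sub>2 X\<^sub>2)
        \<le> C * wasserstein p (input_law T M\<^sub>1 \<zeta>\<^sub>1 W\<^sub>1) (input_law T M\<^sub>2 \<zeta>\<^sub>2 W\<^sub>2)"
    \<comment> \<open>In the goal \<open>C\<close> is a bound variable; in this witness it is the
      constant of the locale.\<close>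
    using const_pos by (intro exI[of _ "6 * exp (3 * C * T)"])
      (simp add: mkv_solution_eq_sol_map(1) Psi_Lipschitz input_law_in_wspace[OF p])
  show "\<forall>(M\<^sub>1 :: 'u measure) \<zeta>\<^sub>1 W\<^sub>1 X\<^sub>1 (M\<^sub>2 :: 'v measure) \<zeta>\<^sub>2 W\<^sub>2 X\<^sub>2.
      Lp_input T p M\<^sub>1 \<zeta>\<^sub>1 W\<^sub>1 \<longrightarrow> Lp_input T p M\<^sub>2 \<zeta>\<^sub>2 W\<^sub>2 \<longrightarrow>
      mkv_solution T p b M\<^sub>1 \<zeta>\<^sub>1 W\<^sub>1 X\<^sub>1 \<longrightarrow> mkv_solution T p b M\<^sub>2 \<zeta>\<^sub>2 W\<^sub>2 X\<^sub>2 \<longrightarrow>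
      input_law T M\<^sub>1 \<zeta>\<^sub>1 W\<^sub>1 = input_law T M\<^sub>2 \<zeta>\<^sub>2 W\<^sub>2 \<longrightarrow>
      path_law T M\<^sub>1 X\<^sub>1 = path_law T M\<^sub>2 X\<^sub>2"
    by (simp add: mkv_solution_eq_sol_map(1))
qed

end
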